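(* Let $G$ be a non-elementary subgroup of $PU(1,n;\mathbb{C})$ which satisfies Condition A. Then $G$ is discrete if and only if for any two loxodromic elements $f,g\in G$ the group $\langle f,g\rangle$ is discrete.
   Context: $PU(1,n;\mathbb{C})$ ($n\ge 1$) is the projectivized group of linear automorphisms of $\mathbb{C}^{n+1}$ preserving a Hermitian form of signature $(1,n)$; it acts by holomorphic isometries on complex hyperbolic space $H^n_{\mathbb{C}}$ and continuously on its closure $\overline{H^n_{\mathbb{C}}}=H^n_{\mathbb{C}}\cup\partial H^n_{\mathbb{C}}$. It carries the topology induced from the matrix group; a subgroup is discrete if it is discrete in this topology, and $I$ denotes the identity. A non-trivial element $g$ is elliptic if it has a fixed point in $H^n_{\mathbb{C}}$; parabolic if it has exactly one fixed point in $\overline{H^n_{\mathbb{C}}}$ and it lies on $\partial H^n_{\mathbb{C}}$; loxodromic if it has exactly two fixed points in $\overline{H^n_{\mathbb{C}}}$ and both lie on $\partial H^n_{\mathbb{C}}$. A subgroup is non-elementary if it contains two non-elliptic elements of infinite order with distinct fixed points. For $g$, $\mathrm{fix}(g)=\{x\in\partial H^n_{\mathbb{C}}: g(x)=x\}$. A subgroup $G$ satisfies Condition A if there is no sequence $\{g_i\}$ of distinct elements of $G$ of finite order with $\mathrm{Card}(\mathrm{fix}(g_i))=\infty$ for all $i$ and $g_i\to I$. *)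

theory Defs
  imports "HOL-Analysis.Analysis" "Jordan_Normal_Form.Matrix"
begin

definition herm :: "nat \<Rightarrow> complex vec \<Rightarrow> complex vec \<Rightarrow> complex" where
  "herm n v w = - (v $ 0 * cnj (w $ 0)) + (\<Sum>i\<in>{1..n}. v $ i * cnj (w $ i))"

definition U1n :: "nat \<Rightarrow> complex mat set" where
  "U1n n = {A \<in> carrier_mat (n+1) (n+1). invertible_mat A \<and>
     (\<forall>v \<in> carrier_vec (n+1). \<forall>w \<in> carrier_vec (n+1). herm n (A *\<^sub>v v) (A *\<^sub>v w) = herm n v w)}"

text \<open>Elements of PU(1,n) are classes of U(1,n) modulo unit scalars.\<close>
definition proj_eq :: "complex mat \<Rightarrow> complex mat \<Rightarrow> bool" where
  "proj_eq A B \<longleftrightarrow> (\<exists>c. cmod c = 1 \<and> A = c \<cdot>\<^sub>m B)"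

definition is_scalar :: "nat \<Rightarrow> complex mat \<Rightarrow> bool" where
  "is_scalar n A \<longleftrightarrow> (\<exists>c. A = c \<cdot>\<^sub>m 1\<^sub>m (n+1))"

text \<open>A subgroup of PU(1,n) is represented by its full preimage in U(1,n).\<close>
definition pu_subgroup :: "nat \<Rightarrow> complex mat set \<Rightarrow> bool" where
  "pu_subgroup n G \<longleftrightarrow> G \<subseteq> U1n n \<and> 1\<^sub>m (n+1) \<in> G \<and>
     (\<forall>A\<in>G. \<forall>B\<in>G. A * B \<in> G) \<and>
     (\<forall>A\<in>G. \<exists>B\<in>G. A * B = 1\<^sub>m (n+1)) \<and>
     (\<forall>A\<in>G. \<forall>c. cmod c = 1 \<longrightarrow> c \<cdot>\<^sub>m A \<in> G)"

text \<open>Subgroup of PU(1,n) generated by a set S (as preimage in U(1,n)).\<close>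
inductive_set pu_gen :: "nat \<Rightarrow> complex mat set \<Rightarrow> complex mat set" for n S where
  gen_base: "A \<in> S \<Longrightarrow> A \<in> pu_gen n S"
| gen_scalar: "cmod c = 1 \<Longrightarrow> c \<cdot>\<^sub>m 1\<^sub>m (n+1) \<in> pu_gen n S"
| gen_mult: "A \<in> pu_gen n S \<Longrightarrow> B \<in> pu_gen n S \<Longrightarrow> A * B \<in> pu_gen n S"
| gen_inv: "A \<in> pu_gen n S \<Longrightarrow> B \<in> carrier_mat (n+1) (n+1) \<Longrightarrow> A * B = 1\<^sub>m (n+1)
            \<Longrightarrow> B \<in> pu_gen n S"

text \<open>Topology: entrywise convergence of matrices; convergence in PU(1,n) (quotient topology)
  means convergence of suitably chosen representatives.\<close>
definition mat_tendsto :: "nat \<Rightarrow> (nat \<Rightarrow> complex mat) \<Rightarrow> complex mat \<Rightarrow> bool" where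
  "mat_tendsto n X B \<longleftrightarrow> (\<forall>i<n+1. \<forall>j<n+1. (\<lambda>k. X k $$ (i,j)) \<longlonglongrightarrow> B $$ (i,j))"

definition pu_tendsto :: "nat \<Rightarrow> (nat \<Rightarrow> complex mat) \<Rightarrow> complex mat \<Rightarrow> bool" where
  "pu_tendsto n X B \<longleftrightarrow> (\<exists>c. (\<forall>k. cmod (c k) = 1) \<and> mat_tendsto n (\<lambda>k. c k \<cdot>\<^sub>m X k) B)"

text \<open>Discrete: every element of the (projectivised) group is isolated (PU(1,n) is metrizable,
  so isolation is expressed sequentially).\<close>
definition pu_discrete :: "nat \<Rightarrow> complex mat set \<Rightarrow> bool" where
  "pu_discrete n G \<longleftrightarrow> (\<forall>A\<in>G. \<not> (\<exists>X. (\<forall>k. X k \<in> G \<and> \<not> proj_eq (X k) A) \<and> pu_tendsto n X A))"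

text \<open>Points of the closure of complex hyperbolic space: complex lines through negative
  (interior) resp. nonzero null (boundary) vectors.\<close>
definition cline :: "complex vec \<Rightarrow> complex vec set" where
  "cline v = {c \<cdot>\<^sub>v v | c. True}"

definition hyp_pts :: "nat \<Rightarrow> complex vec set set" where
  "hyp_pts n = {cline v | v. v \<in> carrier_vec (n+1) \<and> Re (herm n v v) < 0}"

definition bdry_pts :: "nat \<Rightarrow> complex vec set set" where
  "bdry_pts n = {cline v | v. v \<in> carrier_vec (n+1) \<and> v \<noteq> 0\<^sub>v (n+1) \<and> herm n v v = 0}"

definition act :: "complex mat \<Rightarrow> complex vec set \<Rightarrow> complex vec set" where
  "act A x = (\<lambda>v. A *\<^sub>v v) ` x"

definition fixH :: "nat \<Rightarrow> complex mat \<Rightarrow> complex vec set set" where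
  "fixH n A = {x \<in> hyp_pts n. act A x = x}"

definition fixb :: "nat \<Rightarrow> complex mat \<Rightarrow> complex vec set set" where
  "fixb n A = {x \<in> bdry_pts n. act A x = x}"

definition elliptic :: "nat \<Rightarrow> complex mat \<Rightarrow> bool" where
  "elliptic n A \<longleftrightarrow> \<not> is_scalar n A \<and> fixH n A \<noteq> {}"

definition parabolic :: "nat \<Rightarrow> complex mat \<Rightarrow> bool" where
  "parabolic n A \<longleftrightarrow> \<not> is_scalar n A \<and> fixH n A = {} \<and> (\<exists>x. fixb n A = {x})"

definition loxodromic :: "nat \<Rightarrow> complex mat \<Rightarrow> bool" where
  "loxodromic n A \<longleftrightarrow> \<not> is_scalar n A \<and> fixH n A = {} \<and> (\<exists>x y. x \<noteq> y \<and> fixb n A = {x, y})"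

text \<open>Finite order in PU(1,n): some positive power is the identity of PU, i.e. scalar.\<close>
definition finite_order :: "nat \<Rightarrow> complex mat \<Rightarrow> bool" where
  "finite_order n A \<longleftrightarrow> (\<exists>k>0. is_scalar n (A ^\<^sub>m k))"

definition non_elementary :: "nat \<Rightarrow> complex mat set \<Rightarrow> bool" where
  "non_elementary n G \<longleftrightarrow> (\<exists>A\<in>G. \<exists>B\<in>G.
     \<not> is_scalar n A \<and> \<not> is_scalar n B \<and> \<not> elliptic n A \<and> \<not> elliptic n B \<and>
     \<not> finite_order n A \<and> \<not> finite_order n B \<and> fixb n A \<inter> fixb n B = {})"

definition condition_A :: "nat \<Rightarrow> complex mat set \<Rightarrow> bool" where
  "condition_A n G \<longleftrightarrow> \<not> (\<exists>X. (\<forall>k. X k \<in> G) \<and> (\<forall>i j. i \<noteq> j \<longrightarrow> \<not> proj_eq (X i) (X j)) \<and>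
     (\<forall>k. finite_order n (X k) \<and> infinite (fixb n (X k))) \<and> pu_tendsto n X (1\<^sub>m (n+1)))"

end

theory Submission
  imports Defs "Jordan_Normal_Form.Schur_Decomposition"
begin

text \<open>
  Suppose \<open>G\<close> is not discrete and take nontrivial \<open>g\<^sub>k \<in> G\<close> tending to the identity; by Condition A we may assume that no
  \<open>g\<^sub>k\<close> is of finite order with infinitely many boundary fixed points. For a loxodromic \<open>f \<in> G\<close> with trace larger
  than \<open>n + 1\<close> in modulus, \<open>f g\<^sub>k\<close> is loxodromic for large \<open>k\<close>, so \<open>\<langle>f, f g\<^sub>k\<rangle> = \<langle>f, g\<^sub>k\<rangle>\<close> is discrete. The iterated
  commutators \<open>a\<^sub>0 = f g\<^sub>k f\<^sup>-\<^sup>1\<close>, \<open>a\<^sub>i\<^sub>+\<^sub>1 = [g\<^sub>k, a\<^sub>i]\<close> converge to the identity, so some \<open>a\<^sub>i\<close> is trivial. Since \<open>g\<^sub>k\<close> has at most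
  two fixed points in the closed ball, descending in \<open>i\<close> shows that every \<open>a\<^sub>i\<close> fixes them. Hence \<open>f\<close> permutes the fixed
  points of \<open>g\<^sub>k\<close>, which forces them to be boundary fixed points of \<open>f\<close>. Applied to all conjugates of \<open>f\<close>, this yields a
  fixed point \<open>P\<close> of \<open>f\<close> whose \<open>G\<close>-orbit has at most two points, and a non-elliptic isometry preserving such an orbit
  fixes \<open>P\<close>. This contradicts non-elementarity.

  An element of large trace exists because normalised powers of non-elliptic elements accumulate at rank one maps
  \<open>v \<mapsto> H v b \<cdot> a\<close> with \<open>a\<close>, \<open>b\<close> on the boundary; for two elements without common fixed points the product of these limits
  has nonzero trace.
\<close>

unbundle no vec_syntax

declare index_mult_mat(1) [simp del] index_mult_mat_vec [simp del]

section \<open>Complex moduli and compactness in finitely many coordinates\<close>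

lemma mult_cnj_cmod: "z * cnj z = (complex_of_real (cmod z))\<^sup>2"
  by (metis complex_norm_square of_real_power)

text \<open>Bolzano-Weierstrass for finitely many coordinates at once: the subsequence is refined
  one index at a time.\<close>

lemma finite_index_convergent_subseq:
  fixes F :: "nat \<Rightarrow> 'i \<Rightarrow> complex"
  assumes "finite I" and "\<And>i k. i \<in> I \<Longrightarrow> cmod (F k i) \<le> C"
  shows "\<exists>r l. strict_mono r \<and> (\<forall>i\<in>I. (\<lambda>k. F (r k) i) \<longlonglongrightarrow> l i)"
  using assms
proof (induction I)
  case empty
  show ?case by (auto intro!: exI[of _ id] simp: strict_mono_def)
next
  case (insert a I)
  then obtain r l where r: "strict_mono r" "\<And>i. i \<in> I \<Longrightarrow> (\<lambda>k. F (r k) i) \<longlonglongrightarrow> l i"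
    by (metis insertCI)
  have "bounded (range (\<lambda>k. F (r k) a))"
    using insert.prems by (auto simp: bounded_iff)
  then obtain b s where s: "strict_mono s" "((\<lambda>k. F (r k) a) \<circ> s) \<longlonglongrightarrow> b"
    using bounded_imp_convergent_subsequence by metis
  have "(\<lambda>k. F (r (s k)) i) \<longlonglongrightarrow> (l(a := b)) i" if "i \<in> insert a I" for i
  proof (cases "i = a")
    case True then show ?thesis using s by (simp add: o_def)
  next
    case False
    then show ?thesis using LIMSEQ_subseq_LIMSEQ[OF r(2) s(1)] that by (simp add: o_def)
  qed
  then show ?case using strict_mono_o[OF r(1) s(1)]
    by (intro exI[of _ "r \<circ> s"] exI[of _ "l(a := b)"]) (simp add: o_def)
qed

text \<open>The parameter \<open>N\<close> keeps the dimension an atomic term; the final theorem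
  instantiates it with \<open>n + 1\<close>.\<close>

locale hermitian_space =
  fixes n N :: nat
  assumes N_eq: "N = n + 1"
begin

subsection \<open>The Hermitian form and its isometries\<close>

abbreviation H :: "complex vec \<Rightarrow> complex vec \<Rightarrow> complex" where "H \<equiv> herm n"
abbreviation V :: "complex vec set" where "V \<equiv> carrier_vec N"
abbreviation M :: "complex mat set" where "M \<equiv> carrier_mat N N"
abbreviation U :: "complex mat set" where "U \<equiv> U1n n"
abbreviation one :: "complex mat" where "one \<equiv> 1\<^sub>m N"

text \<open>The diagonal of the Gram matrix of the form. It turns the form into one sum over all
  indices, so that the rules for sums apply uniformly.\<close>

definition sg :: "nat \<Rightarrow> complex" where "sg i = (if i = 0 then -1 else 1)"

lemma N_pos [simp]: "0 < N" "N \<noteq> 0" by (auto simp: N_eq)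

lemma sg_simps [simp]: "sg i * sg i = 1" "sg i * (sg i * z) = z" "cnj (sg i) = sg i" "cmod (sg i) = 1"
  by (auto simp: sg_def)

lemma H_alt: "H v w = (\<Sum>i<N. sg i * (v $ i * cnj (w $ i)))"
proof -
  have "{..<N} = insert 0 {1..n}" by (auto simp: N_eq)
  then show ?thesis unfolding herm_def by (simp add: sg_def)
qed

lemma H_add_left: "u \<in> V \<Longrightarrow> v \<in> V \<Longrightarrow> w \<in> V \<Longrightarrow> H (u + v) w = H u w + H v w"
  by (simp add: H_alt algebra_simps sum.distrib)

lemma H_add_right: "u \<in> V \<Longrightarrow> v \<in> V \<Longrightarrow> w \<in> V \<Longrightarrow> H u (v + w) = H u v + H u w"
  by (simp add: H_alt algebra_simps sum.distrib)

lemma H_minus_left: "u \<in> V \<Longrightarrow> v \<in> V \<Longrightarrow> w \<in> V \<Longrightarrow> H (u - v) w = H u w - H v w"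
  by (simp add: H_alt algebra_simps sum_subtractf)

lemma H_minus_right: "u \<in> V \<Longrightarrow> v \<in> V \<Longrightarrow> w \<in> V \<Longrightarrow> H u (v - w) = H u v - H u w"
  by (simp add: H_alt algebra_simps sum_subtractf)

lemma H_smult_left: "u \<in> V \<Longrightarrow> v \<in> V \<Longrightarrow> H (c \<cdot>\<^sub>v u) v = c * H u v"
  by (simp add: H_alt algebra_simps sum_distrib_left)

lemma H_smult_right: "u \<in> V \<Longrightarrow> v \<in> V \<Longrightarrow> H u (c \<cdot>\<^sub>v v) = cnj c * H u v"
  by (simp add: H_alt algebra_simps sum_distrib_left)

lemma H_cnj: "cnj (H u v) = H v u"
  by (simp add: H_alt mult.commute)

lemma H_zero [simp]: "v \<in> V \<Longrightarrow> H v (0\<^sub>v N) = 0" "v \<in> V \<Longrightarrow> H (0\<^sub>v N) v = 0"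
  by (simp_all add: H_alt)

lemmas H_simps = H_add_left H_add_right H_minus_left H_minus_right H_smult_left H_smult_right

lemma H_self: "H v v = of_real (Re (H v v))"
  using H_cnj[of v v] by (simp add: complex_eq_iff)

lemma H_self_spacelike:
  assumes "v $ 0 = 0"
  shows "Re (H v v) = (\<Sum>i<N. (cmod (v $ i))\<^sup>2)"
proof -
  have "sg i * (v $ i * cnj (v $ i)) = of_real ((cmod (v $ i))\<^sup>2)" for i
    using assms by (cases "i = 0") (simp_all add: sg_def mult_cnj_cmod)
  then show ?thesis by (simp add: H_alt)
qed

lemma spacelike_zero:
  assumes "v \<in> V" "v $ 0 = 0" "Re (H v v) \<le> 0"
  shows "v = 0\<^sub>v N"
proof -
  have "(\<Sum>i<N. (cmod (v $ i))\<^sup>2) = 0"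
    using assms by (metis H_self_spacelike order_antisym sum_nonneg zero_le_power2)
  then have "\<forall>i<N. v $ i = 0" by (subst (asm) sum_nonneg_eq_0_iff) auto
  then show ?thesis using assms by (intro eq_vecI) auto
qed

text \<open>Signature \<open>(1,n)\<close>: a plane always meets the positive definite hyperplane \<open>v\<^sub>0 = 0\<close>.\<close>

lemma nonpos_span:
  assumes u: "u \<in> V" "u \<noteq> 0\<^sub>v N" and v: "v \<in> V"
    and np: "\<And>a b. Re (H (a \<cdot>\<^sub>v u + b \<cdot>\<^sub>v v) (a \<cdot>\<^sub>v u + b \<cdot>\<^sub>v v)) \<le> 0"
  obtains c where "v = c \<cdot>\<^sub>v u"
proof -
  have "u = 1 \<cdot>\<^sub>v u + 0 \<cdot>\<^sub>v v" using u v by (intro eq_vecI) auto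
  then have "Re (H u u) \<le> 0" using np[of 1 0] by simp
  then have u0: "u $ 0 \<noteq> 0" using spacelike_zero u by blast
  \<comment> \<open>Makes coordinate 0 of \<open>v - c u\<close> vanish, so this non-positive
    combination lies in the positive definite hyperplane.\<close>
  define c where "c = v $ 0 / u $ 0"
  let ?x = "(-c) \<cdot>\<^sub>v u + 1 \<cdot>\<^sub>v v"
  have "?x = 0\<^sub>v N"
    by (rule spacelike_zero) (use u v u0 np[of "-c" 1] in \<open>auto simp: c_def\<close>)
  then have "\<And>i. i < N \<Longrightarrow> ?x $ i = 0" by simp
  then have "v = c \<cdot>\<^sub>v u" using u v by (intro eq_vecI) auto
  then show thesis by (rule that)
qed

text \<open>Orthogonal null vectors span a totally isotropic subspace, and in signature (1,n) such a
  subspace has dimension at most 1.\<close>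

lemma null_orth_dep:
  assumes "p \<in> V" "q \<in> V" "p \<noteq> 0\<^sub>v N" "H p p = 0" "H q q = 0" "H p q = 0"
  obtains c where "q = c \<cdot>\<^sub>v p"
proof -
  have "H q p = 0" using H_cnj[of p q] assms by simp
  then have "H (a \<cdot>\<^sub>v p + b \<cdot>\<^sub>v q) (a \<cdot>\<^sub>v p + b \<cdot>\<^sub>v q) = 0" for a b
    using assms by (simp add: H_simps)
  with nonpos_span[of p q] assms that show thesis by (metis order_refl zero_complex.sel(1))
qed

text \<open>By orthogonality the form is a sum of two non-positive terms on the span of
  \<open>u\<close> and \<open>v\<close>. Hence \<open>v\<close> is a multiple of \<open>u\<close>,
  and orthogonality to the negative vector \<open>u\<close> makes the factor zero.\<close>

lemma neg_orth_zero:
  assumes u: "u \<in> V" "Re (H u u) < 0" and v: "v \<in> V" "Re (H v v) \<le> 0" and o: "H u v = 0"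
  shows "v = 0\<^sub>v N"
proof -
  have u0: "u \<noteq> 0\<^sub>v N" using u by auto
  have "H v u = 0" using H_cnj[of u v] o by simp
  moreover have "Re (a * cnj a * H u u + b * cnj b * H v v) \<le> 0" for a b
  proof -
    have "a * cnj a * H u u + b * cnj b * H v v = of_real ((cmod a)\<^sup>2 * Re (H u u) + (cmod b)\<^sup>2 * Re (H v v))"
      by (simp add: mult_cnj_cmod flip: H_self)
    moreover have "(cmod a)\<^sup>2 * Re (H u u) \<le> 0" "(cmod b)\<^sup>2 * Re (H v v) \<le> 0"
      using u v by (auto intro: mult_nonneg_nonpos)
    ultimately show ?thesis by simp
  qed
  ultimately have "Re (H (a \<cdot>\<^sub>v u + b \<cdot>\<^sub>v v) (a \<cdot>\<^sub>v u + b \<cdot>\<^sub>v v)) \<le> 0" for a b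
    using u v o by (simp add: H_simps algebra_simps)
  then obtain c where c: "v = c \<cdot>\<^sub>v u" using nonpos_span u0 u v by metis
  then have "cnj c * H u u = 0" using o u by (simp add: H_simps)
  then have "c = 0" using u by auto
  then show ?thesis using c u by auto
qed

lemma H_unit_vec: "i < N \<Longrightarrow> v \<in> V \<Longrightarrow> H v (unit_vec N i) = sg i * v $ i"
proof -
  assume i: "i < N" and v: "v \<in> V"
  have "H v (unit_vec N i) = (\<Sum>j<N. if j = i then sg i * v $ i else 0)"
    unfolding H_alt by (rule sum.cong) (auto simp: i)
  then show ?thesis using i by simp
qed

lemma H_nondeg:
  assumes "x \<in> V" "y \<in> V" "\<And>v. v \<in> V \<Longrightarrow> H x v = H y v"
  shows "x = y"
proof (rule eq_vecI)
  fix i assume "i < dim_vec y"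
  then have i: "i < N" using assms by simp
  then have "sg i * x $ i = sg i * y $ i"
    using assms(3)[of "unit_vec N i"] assms(1,2) by (simp add: H_unit_vec)
  then show "x $ i = y $ i" by (metis sg_simps(2))
qed (use assms in auto)

section \<open>The adjoint and the group structure of the isometries\<close>

text \<open>With \<open>J = diag(-1, 1, \<dots>, 1)\<close> this is \<open>J A\<^sup>* J\<close>, the adjoint for the form; it is the inverse of
  every isometry, so inversion is entrywise isometric and continuous.\<close>

definition adj :: "complex mat \<Rightarrow> complex mat" where
  "adj A = mat N N (\<lambda>(i,j). sg i * sg j * cnj (A $$ (j,i)))"

lemma adj_carrier [simp]: "adj A \<in> M" by (simp add: adj_def)
lemma adj_dim [simp]: "dim_row (adj A) = N" "dim_col (adj A) = N" by (simp_all add: adj_def)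
lemma adj_index: "i < N \<Longrightarrow> j < N \<Longrightarrow> adj A $$ (i,j) = sg i * sg j * cnj (A $$ (j,i))"
  by (simp add: adj_def)

lemma M_mult [simp]: "A \<in> M \<Longrightarrow> B \<in> M \<Longrightarrow> A * B \<in> M" by (rule mult_carrier_mat)

lemma M_vec [simp]: "A \<in> M \<Longrightarrow> v \<in> V \<Longrightarrow> A *\<^sub>v v \<in> V" by (rule mult_mat_vec_carrier)

lemma mult_mat_vec_index: "A \<in> M \<Longrightarrow> v \<in> V \<Longrightarrow> i < N \<Longrightarrow> (A *\<^sub>v v) $ i = (\<Sum>j<N. A $$ (i,j) * v $ j)"
  by (simp add: index_mult_mat_vec scalar_prod_def lessThan_atLeast0)

lemma mult_mat_index: "A \<in> M \<Longrightarrow> B \<in> M \<Longrightarrow> i < N \<Longrightarrow> j < N \<Longrightarrow>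
    (A * B) $$ (i,j) = (\<Sum>k<N. A $$ (i,k) * B $$ (k,j))"
  by (simp add: index_mult_mat(1) scalar_prod_def lessThan_atLeast0)

lemma H_adj:
  assumes "A \<in> M" "v \<in> V" "w \<in> V"
  shows "H (A *\<^sub>v v) w = H v (adj A *\<^sub>v w)"
proof -
  have "H (A *\<^sub>v v) w = (\<Sum>i<N. \<Sum>j<N. sg i * (A $$ (i,j) * v $ j * cnj (w $ i)))"
    unfolding H_alt by (intro sum.cong refl)
       (simp add: assms mult_mat_vec_index sum_distrib_left sum_distrib_right)
  also have "\<dots> = (\<Sum>j<N. \<Sum>i<N. sg i * (A $$ (i,j) * v $ j * cnj (w $ i)))"
    by (rule sum.swap)
  also have "\<dots> = H v (adj A *\<^sub>v w)"
    unfolding H_alt by (intro sum.cong refl)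
       (simp add: assms mult_mat_vec_index adj_index sum_distrib_left algebra_simps)
  finally show ?thesis .
qed

lemma mat_eqI_vec:
  assumes "A \<in> M" "B \<in> M" "\<And>v. v \<in> V \<Longrightarrow> A *\<^sub>v v = B *\<^sub>v v"
  shows "A = B"
proof (rule eq_matI)
  fix i j assume "i < dim_row B" "j < dim_col B"
  then have ij: "i < N" "j < N" using assms by auto
  have *: "C \<in> M \<Longrightarrow> (C *\<^sub>v unit_vec N j) $ i = C $$ (i,j)" for C
    using ij by (simp add: index_mult_mat_vec)
  show "A $$ (i,j) = B $$ (i,j)" using *[of A] *[of B] assms by simp
qed (use assms in auto)

lemma U_M [simp]: "A \<in> U \<Longrightarrow> A \<in> M" by (auto simp: U1n_def N_eq)

lemma U_H: "A \<in> U \<Longrightarrow> v \<in> V \<Longrightarrow> w \<in> V \<Longrightarrow> H (A *\<^sub>v v) (A *\<^sub>v w) = H v w"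
  by (auto simp: U1n_def N_eq)

text \<open>Moving \<open>A\<close> across the form and using invariance shows that
  \<open>adj A * A\<close> pairs with every vector as the identity does; nondegeneracy then applies.
  For square matrices a left inverse is also a right inverse.\<close>

lemma adj_mult_U:
  assumes "A \<in> U"
  shows "adj A * A = one" "A * adj A = one"
proof -
  note A = U_M[OF assms]
  show *: "adj A * A = one"
  proof (rule mat_eqI_vec)
    fix v assume v: "v \<in> V"
    have "adj A *\<^sub>v (A *\<^sub>v v) = v"
    proof (rule H_nondeg)
      fix w assume w: "w \<in> V"
      have "H w (adj A *\<^sub>v (A *\<^sub>v v)) = H (A *\<^sub>v w) (A *\<^sub>v v)"
        using A v w by (intro H_adj[symmetric]) auto
      also have "\<dots> = H w v" using U_H[OF assms w v] .
      finally have "H w (adj A *\<^sub>v (A *\<^sub>v v)) = H w v" .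
      then show "H (adj A *\<^sub>v (A *\<^sub>v v)) w = H v w" by (metis H_cnj)
    qed (use A v in auto)
    then show "adj A * A *\<^sub>v v = one *\<^sub>v v"
      using assoc_mult_mat_vec[of "adj A" N N A N v] A v by simp
  qed (use A in auto)
  show "A * adj A = one"
    by (rule mat_mult_left_right_inverse[OF _ _ *]) (use A in auto)
qed

text \<open>The converse of \<open>adj_mult_U\<close>. It reduces membership in \<open>U\<close> to
  a matrix identity, so that the closure properties below become algebra.\<close>

lemma U_I:
  assumes A: "A \<in> M" and "adj A * A = one"
  shows "A \<in> U"
proof -
  have "A * adj A = one"
    by (rule mat_mult_left_right_inverse[OF _ _ assms(2)]) (use A in auto)
  then have "invertible_mat A"
    using assms unfolding invertible_mat_def inverts_mat_def
    by (metis adj_carrier carrier_matD square_mat.simps)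
  moreover have "H (A *\<^sub>v v) (A *\<^sub>v w) = H v w" if "v \<in> V" "w \<in> V" for v w
  proof -
    have "H (A *\<^sub>v v) (A *\<^sub>v w) = H v (adj A *\<^sub>v (A *\<^sub>v w))"
      using A that by (intro H_adj) auto
    also have "adj A *\<^sub>v (A *\<^sub>v w) = w"
      using assoc_mult_mat_vec[of "adj A" N N A N w] A that assms(2) by simp
    finally show ?thesis .
  qed
  ultimately show ?thesis using A by (auto simp: U1n_def N_eq)
qed

lemma adj_adj: "A \<in> M \<Longrightarrow> adj (adj A) = A"
  by (rule eq_matI) (auto simp: adj_index mult.assoc mult.left_commute)

lemma adj_mult: "A \<in> M \<Longrightarrow> B \<in> M \<Longrightarrow> adj (A * B) = adj B * adj A"
  by (rule eq_matI) (auto simp: adj_index mult_mat_index sum_distrib_left algebra_simps  intro!: sum.cong)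

lemma adj_one: "adj one = one"
  by (rule eq_matI) (auto simp: adj_index)

lemma adj_smult: "A \<in> M \<Longrightarrow> adj (c \<cdot>\<^sub>m A) = cnj c \<cdot>\<^sub>m adj A"
  by (rule eq_matI) (auto simp: adj_index)

lemma M_assoc: "A \<in> M \<Longrightarrow> B \<in> M \<Longrightarrow> C \<in> M \<Longrightarrow> A * B * C = A * (B * C)" by (rule assoc_mult_mat)

lemma M_vec_assoc: "A \<in> M \<Longrightarrow> B \<in> M \<Longrightarrow> v \<in> V \<Longrightarrow> (A * B) *\<^sub>v v = A *\<^sub>v (B *\<^sub>v v)"
  by (rule assoc_mult_mat_vec)

lemma U_one [simp]: "one \<in> U" by (rule U_I) (auto simp: adj_one)

lemma adj_cancel:
  assumes "A \<in> U" "B \<in> M"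
  shows "adj A * (A * B) = B" "A * (adj A * B) = B" "B * A * adj A = B" "B * adj A * A = B"
proof -
  have "adj A * (A * B) = (adj A * A) * B" "A * (adj A * B) = (A * adj A) * B"
    "B * A * adj A = B * (A * adj A)" "B * adj A * A = B * (adj A * A)"
    using assms by (simp_all add: M_assoc)
  then show "adj A * (A * B) = B" "A * (adj A * B) = B" "B * A * adj A = B" "B * adj A * A = B"
    using assms by (simp_all add: adj_mult_U)
qed

lemma U_mult [simp]: "A \<in> U \<Longrightarrow> B \<in> U \<Longrightarrow> A * B \<in> U"
  by (rule U_I) (simp_all add: adj_mult M_assoc adj_cancel adj_mult_U)

lemma U_adj [simp]: "A \<in> U \<Longrightarrow> adj A \<in> U"
  by (rule U_I) (simp_all add: adj_adj adj_mult_U)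

lemma U_smult: "A \<in> U \<Longrightarrow> cmod c = 1 \<Longrightarrow> c \<cdot>\<^sub>m A \<in> U"
  by (rule U_I) (auto simp: adj_smult adj_mult_U mult_smult_distrib[where nr=N and n=N and nc=N] 
     mult_smult_assoc_mat[where nr=N and n=N and nc=N] mult_cnj_cmod mult.commute[of "cnj c"])

lemma U_pow [simp]: "A \<in> U \<Longrightarrow> A ^\<^sub>m k \<in> U"
  by (induction k) (auto simp: carrier_matD[OF U_M])

lemma adj_vec_cancel:
  assumes "A \<in> U" "v \<in> V"
  shows "adj A *\<^sub>v (A *\<^sub>v v) = v" "A *\<^sub>v (adj A *\<^sub>v v) = v"
  using assms by (simp_all flip: M_vec_assoc add: adj_mult_U)

text \<open>Identifies the inverses that occur in \<open>pu_subgroup\<close> and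
  \<open>pu_gen\<close> with the adjoint.\<close>

lemma U_inv_unique: "A \<in> U \<Longrightarrow> B \<in> M \<Longrightarrow> A * B = one \<Longrightarrow> B = adj A"
  by (metis adj_cancel(1) adj_carrier right_mult_one_mat)

lemma U_vec_zero: "A \<in> U \<Longrightarrow> v \<in> V \<Longrightarrow> A *\<^sub>v v = 0\<^sub>v N \<Longrightarrow> v = 0\<^sub>v N"
  by (metis H_nondeg H_zero(2) M_vec U_H U_M zero_carrier_vec)

subsection \<open>Points of the closed ball and fixed-point sets\<close>

definition eig :: "complex mat \<Rightarrow> complex vec \<Rightarrow> bool" where
  "eig A v \<longleftrightarrow> (\<exists>c. A *\<^sub>v v = c \<cdot>\<^sub>v v)"

definition pts :: "complex vec set set" where "pts = hyp_pts n \<union> bdry_pts n"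

lemma M_vec_add: "A \<in> M \<Longrightarrow> v \<in> V \<Longrightarrow> w \<in> V \<Longrightarrow> A *\<^sub>v (v + w) = A *\<^sub>v v + A *\<^sub>v w"
  by (rule mult_add_distrib_mat_vec)

lemma M_vec_minus: "A \<in> M \<Longrightarrow> v \<in> V \<Longrightarrow> w \<in> V \<Longrightarrow> A *\<^sub>v (v - w) = A *\<^sub>v v - A *\<^sub>v w"
  by (rule mult_minus_distrib_mat_vec)

lemma M_vec_smult: "A \<in> M \<Longrightarrow> v \<in> V \<Longrightarrow> A *\<^sub>v (c \<cdot>\<^sub>v v) = c \<cdot>\<^sub>v (A *\<^sub>v v)"
  by (rule mult_mat_vec)

lemma smult_M_vec: "A \<in> M \<Longrightarrow> v \<in> V \<Longrightarrow> (c \<cdot>\<^sub>m A) *\<^sub>v v = c \<cdot>\<^sub>v (A *\<^sub>v v)"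
  by (rule eq_vecI) (auto simp: index_mult_mat_vec)

lemmas M_vec_simps = M_vec_add M_vec_minus M_vec_smult

lemma smult_vec_0 [simp]: "v \<in> V \<Longrightarrow> 0 \<cdot>\<^sub>v v = 0\<^sub>v N" "c \<cdot>\<^sub>v 0\<^sub>v N = (0\<^sub>v N :: complex vec)"
  by (auto intro!: eq_vecI)

lemma smult_vec_eq_0: "v \<in> V \<Longrightarrow> c \<cdot>\<^sub>v v = 0\<^sub>v N \<Longrightarrow> v \<noteq> 0\<^sub>v N \<Longrightarrow> c = (0::complex)"
  by (metis smult_smult_assoc left_inverse one_smult_vec smult_vec_0(2))

lemma smult_vec_cancel: "v \<in> V \<Longrightarrow> v \<noteq> 0\<^sub>v N \<Longrightarrow> a \<cdot>\<^sub>v v = b \<cdot>\<^sub>v v \<Longrightarrow> a = (b::complex)"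
proof -
  assume v: "v \<in> V" "v \<noteq> 0\<^sub>v N" and "a \<cdot>\<^sub>v v = b \<cdot>\<^sub>v v"
  then have "\<forall>i<N. a * v $ i = b * v $ i" by (metis carrier_vecD index_smult_vec(1))
  moreover obtain i where "i < N" "v $ i \<noteq> 0"
    using v by (metis carrier_vecD eq_vecI index_zero_vec)
  ultimately show "a = b" by auto
qed

lemma vec_solve:
  assumes "a \<cdot>\<^sub>v p + b \<cdot>\<^sub>v q = 0\<^sub>v N" "p \<in> V" "q \<in> V" "b \<noteq> (0::complex)"
  shows "q = (- a / b) \<cdot>\<^sub>v p"
proof (rule eq_vecI)
  fix i assume "i < dim_vec (((- a / b) \<cdot>\<^sub>v p))"
  then have i: "i < N" using assms by simp
  then have "(a \<cdot>\<^sub>v p + b \<cdot>\<^sub>v q) $ i = 0" by (simp add: assms(1))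
  moreover have "(a \<cdot>\<^sub>v p + b \<cdot>\<^sub>v q) $ i = a * p $ i + b * q $ i" using i assms(2,3) by simp
  ultimately have "a * p $ i + b * q $ i = 0" by simp
  then show "q $ i = ((- a / b) \<cdot>\<^sub>v p) $ i"
    using i assms by (simp add: field_simps) (metis add.commute add_eq_0_iff)
qed (use assms in auto)

lemma mem_cline [simp]: "v \<in> cline v"
  unfolding cline_def by (auto intro!: exI[of _ 1])

lemma cline_smult: "c \<noteq> 0 \<Longrightarrow> cline (c \<cdot>\<^sub>v v) = cline v"
proof -
  assume c: "c \<noteq> 0"
  have "d \<cdot>\<^sub>v v = (d / c) \<cdot>\<^sub>v (c \<cdot>\<^sub>v v)" for d using c by (simp add: smult_smult_assoc)
  then have "d \<cdot>\<^sub>v v \<in> cline (c \<cdot>\<^sub>v v)" for d unfolding cline_def by blast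
  then show ?thesis unfolding cline_def by (auto simp: smult_smult_assoc)
qed

lemma cline_eq_iff:
  assumes "v \<in> V" "v \<noteq> 0\<^sub>v N" "w \<in> V" "w \<noteq> 0\<^sub>v N"
  shows "cline v = cline w \<longleftrightarrow> (\<exists>c. w = c \<cdot>\<^sub>v v)"
proof
  assume "cline v = cline w"
  then have "w \<in> cline v" by simp
  then show "\<exists>c. w = c \<cdot>\<^sub>v v" by (auto simp: cline_def)
next
  assume "\<exists>c. w = c \<cdot>\<^sub>v v"
  then obtain c where "w = c \<cdot>\<^sub>v v" by auto
  then show "cline v = cline w" using assms cline_smult[of c v] by (cases "c = 0") auto
qed

lemma act_cline: "A \<in> M \<Longrightarrow> v \<in> V \<Longrightarrow> act A (cline v) = cline (A *\<^sub>v v)"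
  unfolding act_def cline_def by (auto simp: M_vec_smult image_iff) (metis M_vec_smult)

lemma hyp_ptsE:
  assumes "x \<in> hyp_pts n"
  obtains v where "v \<in> V" "Re (H v v) < 0" "v \<noteq> 0\<^sub>v N" "x = cline v"
proof -
  obtain v where v: "v \<in> V" "Re (H v v) < 0" "x = cline v"
    using assms by (auto simp: hyp_pts_def N_eq)
  then show thesis using that[of v] by force
qed

lemma bdry_ptsE:
  assumes "x \<in> bdry_pts n"
  obtains v where "v \<in> V" "H v v = 0" "v \<noteq> 0\<^sub>v N" "x = cline v"
  using assms by (auto simp: bdry_pts_def N_eq)

lemma ptsE:
  assumes "x \<in> pts"
  obtains v where "v \<in> V" "Re (H v v) \<le> 0" "v \<noteq> 0\<^sub>v N" "x = cline v"
  using assms unfolding pts_def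
proof
  assume "x \<in> hyp_pts n"
  then show thesis by (elim hyp_ptsE) (use that in force)
next
  assume "x \<in> bdry_pts n"
  then show thesis by (elim bdry_ptsE) (use that in force)
qed

lemma hyp_ptsI: "v \<in> V \<Longrightarrow> Re (H v v) < 0 \<Longrightarrow> cline v \<in> hyp_pts n"
  by (auto simp: hyp_pts_def N_eq)

lemma bdry_ptsI: "v \<in> V \<Longrightarrow> v \<noteq> 0\<^sub>v N \<Longrightarrow> H v v = 0 \<Longrightarrow> cline v \<in> bdry_pts n"
  by (auto simp: bdry_pts_def N_eq)

lemma act_hyp: "A \<in> U \<Longrightarrow> x \<in> hyp_pts n \<Longrightarrow> act A x \<in> hyp_pts n"
  by (elim hyp_ptsE) (simp add: act_cline hyp_ptsI U_H)

lemma act_bdry: "A \<in> U \<Longrightarrow> x \<in> bdry_pts n \<Longrightarrow> act A x \<in> bdry_pts n"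
  by (elim bdry_ptsE) (auto simp: act_cline U_H intro!: bdry_ptsI dest: U_vec_zero)

lemma act_pts: "A \<in> U \<Longrightarrow> x \<in> pts \<Longrightarrow> act A x \<in> pts"
  using act_hyp act_bdry by (auto simp: pts_def)

lemma act_mult: "A \<in> U \<Longrightarrow> B \<in> U \<Longrightarrow> x \<in> pts \<Longrightarrow> act (A * B) x = act A (act B x)"
  by (elim ptsE) (simp add: act_cline M_vec_assoc)

lemma act_scalar: "c \<noteq> 0 \<Longrightarrow> x \<in> pts \<Longrightarrow> act (c \<cdot>\<^sub>m one) x = x"
  by (elim ptsE) (simp add: act_cline smult_M_vec cline_smult)

lemma act_one: "x \<in> pts \<Longrightarrow> act one x = x"
  by (elim ptsE) (simp add: act_cline)

lemma act_adj: "A \<in> U \<Longrightarrow> x \<in> pts \<Longrightarrow> act (adj A) (act A x) = x" "A \<in> U \<Longrightarrow> x \<in> pts \<Longrightarrow> act A (act (adj A) x) = x"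
  by (simp_all flip: act_mult add: adj_mult_U act_one)

lemma act_inj: "A \<in> U \<Longrightarrow> x \<in> pts \<Longrightarrow> y \<in> pts \<Longrightarrow> act A x = act A y \<Longrightarrow> x = y"
  by (metis act_adj(1))

lemma act_eq_iff_eig:
  assumes "A \<in> U" "v \<in> V" "v \<noteq> 0\<^sub>v N"
  shows "act A (cline v) = cline v \<longleftrightarrow> eig A v"
  using assms U_vec_zero[of A v] cline_eq_iff[of v "A *\<^sub>v v"]
  by (auto simp: act_cline eig_def)

lemma fixH_I: "A \<in> U \<Longrightarrow> v \<in> V \<Longrightarrow> Re (H v v) < 0 \<Longrightarrow> eig A v \<Longrightarrow> cline v \<in> fixH n A"
  unfolding fixH_def by (auto intro!: hyp_ptsI) (use act_eq_iff_eig[of A v] in force)+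

lemma fixH_E:
  assumes "x \<in> fixH n A" "A \<in> U"
  obtains v where "v \<in> V" "Re (H v v) < 0" "v \<noteq> 0\<^sub>v N" "x = cline v" "eig A v"
  using assms unfolding fixH_def by (auto elim!: hyp_ptsE simp: act_eq_iff_eig)

lemma fixb_I: "A \<in> U \<Longrightarrow> v \<in> V \<Longrightarrow> v \<noteq> 0\<^sub>v N \<Longrightarrow> H v v = 0 \<Longrightarrow> eig A v \<Longrightarrow> cline v \<in> fixb n A"
  unfolding fixb_def by (auto intro!: bdry_ptsI simp: act_eq_iff_eig)

lemma fixb_E:
  assumes "x \<in> fixb n A" "A \<in> U"
  obtains v where "v \<in> V" "H v v = 0" "v \<noteq> 0\<^sub>v N" "x = cline v" "eig A v"
  using assms unfolding fixb_def by (auto elim!: bdry_ptsE simp: act_eq_iff_eig)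

section \<open>Eigenvalues of isometries and the number of fixed points\<close>

lemma eig_values:
  assumes "A \<in> U" "v \<in> V" "w \<in> V" "A *\<^sub>v v = a \<cdot>\<^sub>v v" "A *\<^sub>v w = b \<cdot>\<^sub>v w" "H v w \<noteq> 0"
  shows "a * cnj b = 1"
proof -
  have "H v w = H (A *\<^sub>v v) (A *\<^sub>v w)" using U_H[OF assms(1-3)] by (rule sym)
  also have "\<dots> = a * cnj b * H v w" using assms by (simp add: H_simps)
  finally show ?thesis using assms by simp
qed

text \<open>A unimodular \<open>a\<close> equals the inverse of its conjugate, so the relation
  \<open>a * cnj b = 1\<close> leaves only \<open>b = a\<close>.\<close>

lemma eig_values_eq:
  assumes "A \<in> U" "v \<in> V" "w \<in> V" "A *\<^sub>v v = a \<cdot>\<^sub>v v" "A *\<^sub>v w = b \<cdot>\<^sub>v w" "H v w \<noteq> 0" "cmod a = 1"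
  shows "b = a"
proof -
  have "a * cnj b = 1" by (rule eig_values) (use assms in auto)
  moreover have "a * cnj a = 1" using assms(7) by (simp add: mult_cnj_cmod)
  ultimately have "a * cnj b = a * cnj a" "a \<noteq> 0" by auto
  then show ?thesis by auto
qed

lemma eig_combine:
  assumes "A \<in> U" "v \<in> V" "w \<in> V" "A *\<^sub>v v = a \<cdot>\<^sub>v v" "A *\<^sub>v w = a \<cdot>\<^sub>v w"
  shows "eig A (x \<cdot>\<^sub>v v + y \<cdot>\<^sub>v w)"
  unfolding eig_def
  by (rule exI[of _ a], rule eq_vecI) (use assms in \<open>auto simp: M_vec_simps algebra_simps\<close>)

text \<open>Equal eigenvalues make every vector in the span of \<open>p\<close> and \<open>q\<close>
  an eigenvector, and a null vector not orthogonal to \<open>q\<close> puts negative vectors into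
  this span.\<close>

lemma null_same_eigenvalue_fixH:
  assumes A: "A \<in> U" and pq: "p \<in> V" "q \<in> V" "p \<noteq> 0\<^sub>v N" "H p p = 0"
    and h: "H p q \<noteq> 0" and e: "A *\<^sub>v p = a \<cdot>\<^sub>v p" "A *\<^sub>v q = a \<cdot>\<^sub>v q"
  shows "fixH n A \<noteq> {}"
proof -
  \<comment> \<open>Each of the two conjugate cross terms becomes the real number
    \<open>- (1 + \<bar>Re (H q q)\<bar>)\<close>, and together they outweigh
    \<open>H q q\<close>.\<close>
  define t where "t = - of_real (1 + \<bar>Re (H q q)\<bar>) / H p q"
  define v where "v = t \<cdot>\<^sub>v p + 1 \<cdot>\<^sub>v q"
  have "H v v = H q q + t * H p q + cnj (t * H p q)"
    using pq H_cnj[of p q] by (simp add: v_def H_simps)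
  moreover have "t * H p q = - of_real (1 + \<bar>Re (H q q)\<bar>)" using h by (simp add: t_def)
  ultimately have "Re (H v v) < 0" by auto
  then have "cline v \<in> fixH n A"
    using pq eig_combine[OF A pq(1,2) e, of t 1] by (auto intro!: fixH_I A simp: v_def)
  then show ?thesis by auto
qed

text \<open>Orthogonal null vectors are proportional and would give the same boundary point.\<close>

lemma null_indep:
  assumes "x \<noteq> y" "x = cline p" "y = cline q" "p \<in> V" "q \<in> V" "p \<noteq> 0\<^sub>v N" "q \<noteq> 0\<^sub>v N" "H p p = 0" "H q q = 0"
  shows "H p q \<noteq> 0"
  using assms null_orth_dep[of p q] cline_eq_iff[of p q] by metis

text \<open>Three distinct boundary fixed points have pairwise non-orthogonal eigenvectors. Their
  eigenvalues satisfy \<open>a * cnj c = 1 = b * cnj c\<close>, hence \<open>a = b\<close>, which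
  produces an interior fixed point.\<close>

lemma fixb_card_le_2:
  assumes A: "A \<in> U" and e: "fixH n A = {}" and xyz: "x \<in> fixb n A" "y \<in> fixb n A" "z \<in> fixb n A"
  shows "x = y \<or> x = z \<or> y = z"
proof (rule ccontr)
  assume "\<not> (x = y \<or> x = z \<or> y = z)"
  then have ne: "x \<noteq> y" "x \<noteq> z" "y \<noteq> z" by auto
  obtain p where p: "p \<in> V" "H p p = 0" "p \<noteq> 0\<^sub>v N" "x = cline p" "eig A p" using fixb_E xyz A by metis
  obtain q where q: "q \<in> V" "H q q = 0" "q \<noteq> 0\<^sub>v N" "y = cline q" "eig A q" using fixb_E xyz A by metis
  obtain r where r: "r \<in> V" "H r r = 0" "r \<noteq> 0\<^sub>v N" "z = cline r" "eig A r" using fixb_E xyz A by metis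
  obtain a b c where abc: "A *\<^sub>v p = a \<cdot>\<^sub>v p" "A *\<^sub>v q = b \<cdot>\<^sub>v q" "A *\<^sub>v r = c \<cdot>\<^sub>v r"
    using p q r by (auto simp: eig_def)
  have h: "H p q \<noteq> 0" "H p r \<noteq> 0" "H q r \<noteq> 0"
    using null_indep[OF ne(1)] null_indep[OF ne(2)] null_indep[OF ne(3)] p q r by auto
  have v: "a * cnj b = 1" "a * cnj c = 1" "b * cnj c = 1"
    using eig_values[OF A] p q r abc h by blast+
  then have "a = b" by (metis complex_cnj_zero_iff mult_cancel_right mult_zero_right zero_neq_one)
  then show False using null_same_eigenvalue_fixH[OF A p(1) q(1) p(3) p(2) h(1)] abc e by auto
qed

text \<open>Two fixed lines, one of them negative, have the same eigenvalue, so the whole projective line through them is fixed.\<close>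

lemma elliptic_two_fixed:
  assumes A: "A \<in> U" and x: "x \<in> fixH n A" and y: "y \<in> pts" "act A y = y" "y \<noteq> x"
  shows "infinite (fixb n A)"
proof -
  obtain v where v: "v \<in> V" "Re (H v v) < 0" "v \<noteq> 0\<^sub>v N" "x = cline v" "eig A v"
    using fixH_E x A by metis
  obtain w where w: "w \<in> V" "Re (H w w) \<le> 0" "w \<noteq> 0\<^sub>v N" "y = cline w"
    using ptsE y by metis
  have "eig A w" using act_eq_iff_eig[OF A w(1,3)] y w by simp
  obtain a b where ab: "A *\<^sub>v v = a \<cdot>\<^sub>v v" "A *\<^sub>v w = b \<cdot>\<^sub>v w"
    using v \<open>eig A w\<close> by (auto simp: eig_def)
  have Hvv: "H v v \<noteq> 0" using v by auto
  have "a * cnj a = 1" using eig_values[OF A v(1) v(1) ab(1) ab(1)] Hvv by simp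
  then have a1: "cmod a = 1" by (metis complex_mod_sqrt_Re_mult_cnj one_complex.sel(1) real_sqrt_one)
  have "H v w \<noteq> 0" using neg_orth_zero[of v w] v w by auto
  then have "b = a" using eig_values_eq[OF A v(1) w(1) ab] a1 by auto
  \<comment> \<open>The component of \<open>w\<close> orthogonal to \<open>v\<close>; it is positive
    because \<open>v\<close> is negative.\<close>
  define u where "u = w + (- (H w v / H v v)) \<cdot>\<^sub>v v"
  have u: "u \<in> V" "H u v = 0" using v w Hvv by (auto simp: u_def H_simps)
  have vu: "H v u = 0" using u H_cnj[of u v] by simp
  have u0: "u \<noteq> 0\<^sub>v N"
  proof
    assume "u = 0\<^sub>v N"
    then have "(- (H w v / H v v)) \<cdot>\<^sub>v v + 1 \<cdot>\<^sub>v w = 0\<^sub>v N"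
      using v w by (auto simp: u_def comm_add_vec[of w N])
    from vec_solve[OF this v(1) w(1)] have "\<exists>c. w = c \<cdot>\<^sub>v v" by auto
    then show False using cline_eq_iff[of v w] v w y by blast
  qed
  have up: "Re (H u u) > 0"
    using neg_orth_zero[OF v(1,2) u(1) _ vu] u0 by force
  \<comment> \<open>Scales \<open>u\<close> so that its norm is opposite to that of
    \<open>v\<close>. The vectors \<open>g t\<close> with unimodular \<open>t\<close> are then null
    and form a circle of boundary points.\<close>
  define r where "r = sqrt (- Re (H v v) / Re (H u u))"
  have r: "r > 0" "r\<^sup>2 * Re (H u u) = - Re (H v v)"
  proof -
    have "0 < - Re (H v v) / Re (H u u)" using v(2) up by (intro divide_pos_pos) auto
    then show "r > 0" "r\<^sup>2 * Re (H u u) = - Re (H v v)"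
      using up unfolding r_def by (simp_all add: real_sqrt_gt_zero)
  qed
  define g where "g t = v + (of_real r * t) \<cdot>\<^sub>v u" for t :: complex
  have gV: "g t \<in> V" for t using v u by (simp add: g_def)
  have nul: "H (g t) (g t) = 0" if "cmod t = 1" for t
  proof -
    have "H (g t) (g t) = H v v + of_real (r\<^sup>2) * (t * cnj t) * H u u"
      using v u vu by (simp add: g_def H_simps power2_eq_square algebra_simps)
    also have "\<dots> = of_real (Re (H v v) + r\<^sup>2 * Re (H u u))"
      using that H_self[of u] H_self[of v] by (simp add: mult_cnj_cmod)
    finally show ?thesis using r by simp
  qed
  \<comment> \<open>The pairing with \<open>v\<close> does not depend on \<open>t\<close>: it shows
    that \<open>g t\<close> is nonzero, and that proportional \<open>g s\<close> and
    \<open>g t\<close> are equal.\<close>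
  have gv: "H (g t) v = H v v" for t using v u by (simp add: g_def H_simps)
  have g0: "g t \<noteq> 0\<^sub>v N" for t using gv[of t] Hvv v by auto
  have eg: "eig A (g t)" for t
  proof -
    have "eig A ((1 - of_real r * t * (H w v / H v v)) \<cdot>\<^sub>v v + (of_real r * t) \<cdot>\<^sub>v w)"
      by (rule eig_combine[OF A v(1) w(1)]) (use ab \<open>b = a\<close> in auto)
    also have "(1 - of_real r * t * (H w v / H v v)) \<cdot>\<^sub>v v + (of_real r * t) \<cdot>\<^sub>v w = g t"
      using v w unfolding g_def u_def by (intro eq_vecI) (auto simp: algebra_simps)
    finally show ?thesis .
  qed
  have "(\<lambda>t. cline (g t)) ` sphere 0 1 \<subseteq> fixb n A"
    using nul gV g0 eg by (auto intro!: fixb_I A)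
  moreover have "inj_on (\<lambda>t. cline (g t)) (sphere 0 1)"
  proof (rule inj_onI)
    fix s t assume "cline (g s) = cline (g t)"
    then obtain c where c: "g t = c \<cdot>\<^sub>v g s" using cline_eq_iff gV g0 by blast
    then have "H v v = c * H v v" using gv[of t] gv[of s] gV v by (simp add: H_simps)
    then have "c = 1" using Hvv by simp
    then have "H (g t) u = H (g s) u" using c by simp
    then have "of_real r * t * H u u = of_real r * s * H u u"
      using v u vu by (simp add: g_def H_simps)
    then show "s = t" using r up by auto
  qed
  moreover have "infinite (sphere (0::complex) 1)"
  proof -
    have "{-1..1} \<subseteq> Re ` sphere 0 1"
    proof
      fix x :: real assume "x \<in> {-1..1}"
      then have "x\<^sup>2 \<le> 1" using abs_square_le_1[of x] by (auto simp: abs_le_iff)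
      then have "Complex x (sqrt (1 - x\<^sup>2)) \<in> sphere 0 1" by (simp add: cmod_def)
      then show "x \<in> Re ` sphere 0 1" by (metis complex.sel(1) image_eqI)
    qed
    moreover have "infinite {-1..1::real}" by (simp add: infinite_Icc_iff)
    ultimately show ?thesis by (metis finite_imageI finite_subset)
  qed
  ultimately show ?thesis by (meson finite_imageD finite_subset)
qed

text \<open>In terms of \<open>p\<close> and \<open>q\<close> the map is antidiagonal with entries
  \<open>s\<close> and \<open>t\<close>, so its eigenvalues are the square roots of
  \<open>s * t\<close>.\<close>

lemma swap_eigenvectors:
  assumes A: "A \<in> M" and pq: "p \<in> V" "q \<in> V" and "A *\<^sub>v p = s \<cdot>\<^sub>v q" "A *\<^sub>v q = t \<cdot>\<^sub>v p"
    and m: "m\<^sup>2 = s * t"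
  shows "A *\<^sub>v (m \<cdot>\<^sub>v p + s \<cdot>\<^sub>v q) = m \<cdot>\<^sub>v (m \<cdot>\<^sub>v p + s \<cdot>\<^sub>v q)"
proof -
  have "m * m = s * t" using m by (simp add: power2_eq_square)
  then show ?thesis using assms
    by (intro eq_vecI) (auto simp: M_vec_simps distrib_left mult.assoc[symmetric])
qed

text \<open>Both \<open>m p + s q\<close> and \<open>- m p + s q\<close> with \<open>m\<^sup>2 = s t\<close> are eigenvectors, and they have opposite nonzero norms.\<close>

lemma swap_fixH:
  assumes A: "A \<in> U" and x: "x \<in> bdry_pts n" "y \<in> bdry_pts n" "x \<noteq> y"
    and sw: "act A x = y" "act A y = x"
  shows "fixH n A \<noteq> {}"
proof -
  obtain p where p: "p \<in> V" "H p p = 0" "p \<noteq> 0\<^sub>v N" "x = cline p" using x bdry_ptsE by metis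
  obtain q where q: "q \<in> V" "H q q = 0" "q \<noteq> 0\<^sub>v N" "y = cline q" using x bdry_ptsE by metis
  have h: "H p q \<noteq> 0" using null_indep x p q by metis
  have "cline (A *\<^sub>v p) = cline q" "cline (A *\<^sub>v q) = cline p"
    using sw p q A by (auto simp: act_cline)
  then have "A *\<^sub>v p \<in> cline q" "A *\<^sub>v q \<in> cline p" using mem_cline by blast+
  then obtain s t where st: "A *\<^sub>v p = s \<cdot>\<^sub>v q" "A *\<^sub>v q = t \<cdot>\<^sub>v p" unfolding cline_def by auto
  define m where "m = csqrt (s * t)"
  have m2: "m\<^sup>2 = s * t" by (simp add: m_def)
  have hq: "H q p = cnj (H p q)" by (simp add: H_cnj)
  have "H p q = H (A *\<^sub>v p) (A *\<^sub>v q)" using A p q by (simp add: U_H)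
  also have "\<dots> = s * cnj t * cnj (H p q)" using st p q by (simp add: H_simps hq)
  finally have e1: "s * cnj t * cnj (H p q) = H p q" by simp
  define z where "z = m * cnj s * H p q"
  have s0: "s \<noteq> 0" using e1 h by auto
  \<comment> \<open>By \<open>e1\<close> the square of \<open>z\<close> is a positive real, so
    \<open>z\<close> is real and nonzero. The norm of \<open>m p + s q\<close> is
    \<open>2 * Re z\<close>, and replacing \<open>m\<close> by \<open>- m\<close> changes its
    sign.\<close>
  have "z\<^sup>2 = (s * cnj s) * (cnj (s * cnj t * cnj (H p q)) * H p q)"
    by (simp add: z_def power_mult_distrib m2) (simp add: power2_eq_square)
  also have "\<dots> = of_real ((cmod s * cmod (H p q))\<^sup>2)"
    unfolding e1 by (simp add: mult_cnj_cmod mult.commute[of "cnj (H p q)"] power_mult_distrib)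
  finally have "z = of_real (cmod s * cmod (H p q)) \<or> z = - of_real (cmod s * cmod (H p q))"
    by (simp only: of_real_power power2_eq_iff)
  then have Rez: "Re z \<noteq> 0" using s0 h by auto
  have *: "H (m' \<cdot>\<^sub>v p + s \<cdot>\<^sub>v q) (m' \<cdot>\<^sub>v p + s \<cdot>\<^sub>v q) = m' * cnj s * H p q + cnj (m' * cnj s * H p q)" for m'
    using p q by (simp add: H_simps hq)
  have R: "Re (H (m' \<cdot>\<^sub>v p + s \<cdot>\<^sub>v q) (m' \<cdot>\<^sub>v p + s \<cdot>\<^sub>v q)) = 2 * Re (m' * cnj s * H p q)" for m'
    unfolding * by (simp only: plus_complex.sel cnj.sel mult_2)
  have mz: "- m * cnj s * H p q = - z" by (simp add: z_def)
  have **: "\<exists>m'. m'\<^sup>2 = s * t \<and> Re (H (m' \<cdot>\<^sub>v p + s \<cdot>\<^sub>v q) (m' \<cdot>\<^sub>v p + s \<cdot>\<^sub>v q)) < 0"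
  proof (cases "Re z < 0")
    case True
    then show ?thesis using m2 unfolding R z_def by (intro exI[of _ m]) auto
  next
    case False
    then have "Re (- m * cnj s * H p q) < 0" using Rez unfolding mz by simp
    then show ?thesis using m2 unfolding R by (intro exI[of _ "-m"]) auto
  qed
  then obtain m' where m': "m'\<^sup>2 = s * t" "Re (H (m' \<cdot>\<^sub>v p + s \<cdot>\<^sub>v q) (m' \<cdot>\<^sub>v p + s \<cdot>\<^sub>v q)) < 0" by auto
  have "eig A (m' \<cdot>\<^sub>v p + s \<cdot>\<^sub>v q)"
    unfolding eig_def using swap_eigenvectors[OF U_M[OF A] p(1) q(1) st m'(1)] by blast
  then show ?thesis using fixH_I[OF A _ m'(2)] p q by auto
qed

subsection \<open>Matrix norm and convergence\<close>

text \<open>The entrywise l1 norm: submultiplicative, compatible with entrywise convergence, and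
  invariant under \<open>adj\<close>, hence under inversion of isometries. The identity has norm
  \<open>N\<close>.\<close>

definition nm :: "complex mat \<Rightarrow> real" where
  "nm A = (\<Sum>i<N. \<Sum>j<N. cmod (A $$ (i,j)))"

lemma nm_nonneg [simp]: "0 \<le> nm A"
  by (auto simp: nm_def intro!: sum_nonneg)

lemma entry_le_nm: "i < N \<Longrightarrow> j < N \<Longrightarrow> cmod (A $$ (i,j)) \<le> nm A"
proof -
  assume ij: "i < N" "j < N"
  have "cmod (A $$ (i,j)) \<le> (\<Sum>j<N. cmod (A $$ (i,j)))"
    using ij by (intro member_le_sum) auto
  also have "\<dots> \<le> nm A" unfolding nm_def
    using ij by (intro member_le_sum[where f="\<lambda>i. \<Sum>j<N. cmod (A $$ (i,j))"]) (auto intro!: sum_nonneg)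
  finally show ?thesis .
qed

lemma nm_zero: "A \<in> M \<Longrightarrow> nm A = 0 \<Longrightarrow> i < N \<Longrightarrow> j < N \<Longrightarrow> A $$ (i,j) = 0"
  using entry_le_nm[of i j A] by simp

lemma nm_add: "A \<in> M \<Longrightarrow> B \<in> M \<Longrightarrow> nm (A + B) \<le> nm A + nm B"
  unfolding nm_def sum.distrib[symmetric] by (intro sum_mono) (simp add: norm_triangle_ineq)

lemma nm_minus: "A \<in> M \<Longrightarrow> B \<in> M \<Longrightarrow> nm (A - B) \<le> nm A + nm B"
  unfolding nm_def sum.distrib[symmetric] by (intro sum_mono) (simp add: norm_triangle_ineq4)

lemma nm_smult: "A \<in> M \<Longrightarrow> nm (c \<cdot>\<^sub>m A) = cmod c * nm A"
  unfolding nm_def by (simp add: norm_mult sum_distrib_left)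

lemma nm_mult:
  assumes "A \<in> M" "B \<in> M"
  shows "nm (A * B) \<le> nm A * nm B"
proof -
  have "nm (A * B) \<le> (\<Sum>i<N. \<Sum>j<N. \<Sum>k<N. cmod (A $$ (i,k)) * cmod (B $$ (k,j)))"
    unfolding nm_def
    by (intro sum_mono) (auto simp: mult_mat_index assms norm_mult intro!: order_trans[OF norm_sum])
  also have "\<dots> = (\<Sum>i<N. \<Sum>k<N. cmod (A $$ (i,k)) * (\<Sum>j<N. cmod (B $$ (k,j))))"
    unfolding sum_distrib_left by (intro sum.cong refl sum.swap)
  also have "\<dots> \<le> (\<Sum>i<N. \<Sum>k<N. cmod (A $$ (i,k)) * nm B)"
    by (intro sum_mono mult_left_mono)
       (auto simp: nm_def intro!: member_le_sum[where f="\<lambda>i. \<Sum>j<N. cmod (B $$ (i,j))"] sum_nonneg)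
  also have "\<dots> = nm A * nm B" by (simp add: nm_def sum_distrib_right)
  finally show ?thesis .
qed

lemma nm_adj: "nm (adj A) = nm A"
proof -
  have "nm (adj A) = (\<Sum>i<N. \<Sum>j<N. cmod (A $$ (j,i)))"
    unfolding nm_def by (intro sum.cong refl) (simp add: adj_index norm_mult)
  also have "\<dots> = nm A" unfolding nm_def by (rule sum.swap)
  finally show ?thesis .
qed

lemma nm_one: "nm one = real N"
proof -
  have "nm one = (\<Sum>i<N. \<Sum>j<N. if j = i then 1 else 0)"
    unfolding nm_def by (intro sum.cong refl) auto
  then show ?thesis by simp
qed

lemma adj_minus_one: "A \<in> M \<Longrightarrow> adj (A - one) = adj A - one"
  by (rule eq_matI) (auto simp: adj_index algebra_simps)

lemma nm_adj_minus_one: "A \<in> M \<Longrightarrow> nm (adj A - one) = nm (A - one)"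
  by (metis adj_minus_one nm_adj)

section \<open>Entrywise convergence of matrices and vectors\<close>

definition tends :: "(nat \<Rightarrow> complex mat) \<Rightarrow> complex mat \<Rightarrow> bool" where
  "tends X B \<longleftrightarrow> (\<forall>i<N. \<forall>j<N. (\<lambda>k. X k $$ (i,j)) \<longlonglongrightarrow> B $$ (i,j))"

lemma tends_mat_tendsto: "tends X B \<longleftrightarrow> mat_tendsto n X B"
  by (simp only: tends_def mat_tendsto_def flip: N_eq)

lemma tendsD: "tends X B \<Longrightarrow> i < N \<Longrightarrow> j < N \<Longrightarrow> (\<lambda>k. X k $$ (i,j)) \<longlonglongrightarrow> B $$ (i,j)"
  by (simp add: tends_def)

lemma tends_const: "tends (\<lambda>k. A) A" by (simp add: tends_def)

lemma tends_mult:
  assumes "tends X A" "tends Y B" "\<And>k. X k \<in> M" "\<And>k. Y k \<in> M" "A \<in> M" "B \<in> M"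
  shows "tends (\<lambda>k. X k * Y k) (A * B)"
  unfolding tends_def
  by (auto simp: mult_mat_index assms intro!: tendsto_intros tendsD assms)

lemma tends_adj:
  assumes "tends X A"
  shows "tends (\<lambda>k. adj (X k)) (adj A)"
  unfolding tends_def
  by (auto simp: adj_index intro!: tendsto_intros tendsD assms)

lemma tends_smult:
  assumes "tends X A" "\<And>k. X k \<in> M" "A \<in> M" "c \<longlonglongrightarrow> d"
  shows "tends (\<lambda>k. c k \<cdot>\<^sub>m X k) (d \<cdot>\<^sub>m A)"
  unfolding tends_def
  using assms(2,3) by (auto simp: carrier_matD[OF assms(2)] intro!: tendsto_intros tendsD assms(1,4))

lemma tends_minus:
  assumes "tends X A" "tends Y B" "\<And>k. X k \<in> M" "\<And>k. Y k \<in> M" "A \<in> M" "B \<in> M"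
  shows "tends (\<lambda>k. X k - Y k) (A - B)"
  unfolding tends_def
  by (auto simp: carrier_matD[OF assms(4)] carrier_matD[OF assms(6)] intro!: tendsto_intros tendsD assms)

lemma tends_subseq: "tends X A \<Longrightarrow> strict_mono r \<Longrightarrow> tends (\<lambda>k. X (r k)) A"
  unfolding tends_def using LIMSEQ_subseq_LIMSEQ[of "\<lambda>k. X k $$ _"] by (auto simp: o_def)

lemma tends_nm:
  assumes "tends X A"
  shows "(\<lambda>k. nm (X k)) \<longlonglongrightarrow> nm A"
  unfolding nm_def by (intro tendsto_intros) (auto intro: tendsD assms)

lemma tends_unique:
  assumes "tends X A" "tends X B" "A \<in> M" "B \<in> M"
  shows "A = B"
proof (rule eq_matI)
  fix i j assume "i < dim_row B" "j < dim_col B"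
  then show "A $$ (i,j) = B $$ (i,j)"
    using assms tendsD LIMSEQ_unique by (metis carrier_matD)
qed (use assms in auto)

lemma nm_to_zero_tends:
  assumes X: "\<And>k. X k \<in> M" and A: "A \<in> M" and "(\<lambda>k. nm (X k - A)) \<longlonglongrightarrow> 0"
  shows "tends X A"
  unfolding tends_def
proof (intro allI impI)
  fix i j assume ij: "i < N" "j < N"
  have "cmod (X k $$ (i,j) - A $$ (i,j)) \<le> nm (X k - A)" for k
    using entry_le_nm[OF ij, of "X k - A"] ij A X[of k] by simp
  then have "(\<lambda>k. X k $$ (i,j) - A $$ (i,j)) \<longlonglongrightarrow> 0"
    by (intro Lim_null_comparison[OF _ assms(3)]) simp
  then show "(\<lambda>k. X k $$ (i,j)) \<longlonglongrightarrow> A $$ (i,j)" by (rule LIM_zero_cancel)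
qed

lemma tends_nm_minus:
  assumes "\<And>k. X k \<in> M" "A \<in> M" "tends X A"
  shows "(\<lambda>k. nm (X k - A)) \<longlonglongrightarrow> 0"
proof -
  have "(\<lambda>k. nm (X k - A)) \<longlonglongrightarrow> nm (A - A)"
    by (intro tends_nm tends_minus assms tends_const)
  moreover have "nm (A - A) = 0" using assms by (simp add: nm_def)
  ultimately show ?thesis by simp
qed

definition vtends :: "(nat \<Rightarrow> complex vec) \<Rightarrow> complex vec \<Rightarrow> bool" where
  "vtends X v \<longleftrightarrow> (\<forall>i<N. (\<lambda>k. X k $ i) \<longlonglongrightarrow> v $ i)"

lemma vtends_H:
  assumes "vtends X v" "vtends Y w"
  shows "(\<lambda>k. H (X k) (Y k)) \<longlonglongrightarrow> H v w"
  unfolding H_alt using assms by (auto simp: vtends_def intro!: tendsto_intros)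

lemma tends_vec:
  assumes "tends X A" "\<And>k. X k \<in> M" "A \<in> M" "v \<in> V"
  shows "vtends (\<lambda>k. X k *\<^sub>v v) (A *\<^sub>v v)"
  unfolding vtends_def using assms
  by (auto simp: mult_mat_vec_index intro!: tendsto_intros tendsD)

lemma mat_convergent_subseq:
  fixes X :: "nat \<Rightarrow> complex mat"
  assumes "\<And>k. nm (X k) \<le> C"
  obtains r :: "nat \<Rightarrow> nat" and A where "strict_mono r" "A \<in> M" "tends (\<lambda>k. X (r k)) A"
proof -
  have "\<exists>r l. strict_mono r \<and> (\<forall>i\<in>{..<N}\<times>{..<N}. (\<lambda>k. X (r k) $$ i) \<longlonglongrightarrow> l i)"
    by (rule finite_index_convergent_subseq[where C=C and F="\<lambda>k i. X k $$ i"])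
       (auto intro: order_trans[OF entry_le_nm assms])
  then obtain r l where "strict_mono r" "\<forall>i\<in>{..<N}\<times>{..<N}. (\<lambda>k. X (r k) $$ i) \<longlonglongrightarrow> l i" by auto
  then show thesis by (intro that[of r "mat N N l"]) (auto simp: tends_def)
qed

lemma vec_convergent_subseq:
  fixes X :: "nat \<Rightarrow> complex vec"
  assumes "\<And>k i. i < N \<Longrightarrow> cmod (X k $ i) \<le> C"
  obtains r :: "nat \<Rightarrow> nat" and v where "strict_mono r" "v \<in> V" "vtends (\<lambda>k. X (r k)) v"
proof -
  have "\<exists>r l. strict_mono r \<and> (\<forall>i\<in>{..<N}. (\<lambda>k. X (r k) $ i) \<longlonglongrightarrow> l i)"
    by (rule finite_index_convergent_subseq[where C=C and F="\<lambda>k i. X k $ i"]) (use assms in auto)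
  then obtain r l where "strict_mono r" "\<forall>i\<in>{..<N}. (\<lambda>k. X (r k) $ i) \<longlonglongrightarrow> l i" by auto
  then show thesis by (intro that[of r "vec N l"]) (auto simp: vtends_def)
qed

text \<open>Compare both sides of \<open>(A - one) v = (c - 1) v\<close> at a coordinate where
  \<open>v\<close> has largest modulus.\<close>

lemma eigenvalue_near_one:
  assumes A: "A \<in> M" and v: "v \<in> V" "v \<noteq> 0\<^sub>v N" and e: "A *\<^sub>v v = c \<cdot>\<^sub>v v"
  shows "cmod (c - 1) \<le> nm (A - one)"
proof -
  obtain i0 where i0: "i0 < N" "v $ i0 \<noteq> 0"
    using v by (metis carrier_vecD eq_vecI index_zero_vec)
  obtain i where i: "i < N" "\<And>j. j < N \<Longrightarrow> cmod (v $ j) \<le> cmod (v $ i)"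
  proof -
    have "\<exists>i\<in>{..<N}. \<forall>j\<in>{..<N}. cmod (v $ j) \<le> cmod (v $ i)"
      using obtains_MAX[of "{..<N}" "\<lambda>j. cmod (v $ j)"] i0(1)
      by (metis Max_ge finite_imageI finite_lessThan imageI lessThan_iff empty_iff)
    then show thesis using that by auto
  qed
  have vi: "cmod (v $ i) > 0" using i(2)[OF i0(1)] i0(2) by (metis norm_le_zero_iff not_le order_trans)
  have "((A - one) *\<^sub>v v) = (c - 1) \<cdot>\<^sub>v v"
  proof -
    have "(A - one) *\<^sub>v v = A *\<^sub>v v - one *\<^sub>v v"
      using A v by (intro minus_mult_distrib_mat_vec[where nr=N and nc=N]) auto
    also have "\<dots> = (c - 1) \<cdot>\<^sub>v v" using v unfolding e by (intro eq_vecI) (auto simp: algebra_simps)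
    finally show ?thesis .
  qed
  then have "(c - 1) * v $ i = ((A - one) *\<^sub>v v) $ i" using i v by simp
  also have "\<dots> = (\<Sum>j<N. (A - one) $$ (i,j) * v $ j)"
    using i v A by (intro mult_mat_vec_index) auto
  finally have "cmod (c - 1) * cmod (v $ i) \<le> (\<Sum>j<N. cmod ((A - one) $$ (i,j)) * cmod (v $ j))"
    by (metis (no_types, lifting) norm_mult norm_sum sum.cong)
  also have "\<dots> \<le> (\<Sum>j<N. cmod ((A - one) $$ (i,j)) * cmod (v $ i))"
    using i by (intro sum_mono mult_left_mono) auto
  also have "\<dots> \<le> nm (A - one) * cmod (v $ i)"
    unfolding sum_distrib_right[symmetric] nm_def
    using i by (intro mult_right_mono member_le_sum[where f="\<lambda>i. \<Sum>j<N. cmod ((A - one) $$ (i,j))"]) (auto intro!: sum_nonneg)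
  finally show ?thesis using vi by simp
qed

text \<open>A swap has both \<open>m\<close> and \<open>- m\<close> as eigenvalues, and these cannot both be close to 1.\<close>

lemma near_one_no_swap:
  assumes A: "A \<in> U" "nm (A - one) < 1" and x: "x \<in> pts" "y \<in> pts" "x \<noteq> y"
    and sw: "act A x = y" "act A y = x"
  shows False
proof -
  obtain p where p: "p \<in> V" "p \<noteq> 0\<^sub>v N" "x = cline p" using x ptsE by metis
  obtain q where q: "q \<in> V" "q \<noteq> 0\<^sub>v N" "y = cline q" using x ptsE by metis
  have "cline (A *\<^sub>v p) = cline q" "cline (A *\<^sub>v q) = cline p"
    using sw p q A by (auto simp: act_cline)
  then have "A *\<^sub>v p \<in> cline q" "A *\<^sub>v q \<in> cline p" using mem_cline by blast+
  then obtain s t where st: "A *\<^sub>v p = s \<cdot>\<^sub>v q" "A *\<^sub>v q = t \<cdot>\<^sub>v p" unfolding cline_def by auto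
  have s0: "s \<noteq> 0" using U_vec_zero[OF A(1) p(1)] st p q by auto
  \<comment> \<open>The points are distinct, so \<open>p\<close> and \<open>q\<close> are
    independent and both candidate eigenvectors are nonzero.\<close>
  have ne: "m \<cdot>\<^sub>v p + s \<cdot>\<^sub>v q \<noteq> 0\<^sub>v N" for m
  proof
    assume "m \<cdot>\<^sub>v p + s \<cdot>\<^sub>v q = 0\<^sub>v N"
    from vec_solve[OF this p(1) q(1) s0] have "\<exists>c. q = c \<cdot>\<^sub>v p" by auto
    then show False using cline_eq_iff[of p q] p q x by blast
  qed
  have *: "cmod (m - 1) < 1" if "m\<^sup>2 = s * t" for m
    using eigenvalue_near_one[OF U_M[OF A(1)] _ ne swap_eigenvectors[OF U_M[OF A(1)] p(1) q(1) st that]] p q A by simp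
  define m where "m = csqrt (s * t)"
  have "cmod (m - 1) < 1" "cmod (- m - 1) < 1" using *[of m] *[of "-m"] by (simp_all add: m_def)
  \<comment> \<open>The sum \<open>(m - 1) + (- m - 1)\<close> is \<open>- 2\<close>, while the two
    bounds give modulus less than 2.\<close>
  moreover have "cmod ((m - 1) + (- m - 1)) \<le> cmod (m - 1) + cmod (- m - 1)" by (rule norm_triangle_ineq)
  ultimately show False by simp
qed

subsection \<open>Bounded and unbounded powers\<close>

lemma vtends_mult: "vtends X v \<Longrightarrow> A \<in> M \<Longrightarrow> (\<And>k. X k \<in> V) \<Longrightarrow> v \<in> V \<Longrightarrow> vtends (\<lambda>k. A *\<^sub>v X k) (A *\<^sub>v v)"
  unfolding vtends_def by (auto simp: mult_mat_vec_index intro!: tendsto_intros)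

lemma pow_Suc_left: "A \<in> M \<Longrightarrow> A ^\<^sub>m Suc k = A * A ^\<^sub>m k"
proof (induction k)
  case (Suc k)
  have "A ^\<^sub>m Suc (Suc k) = A * A ^\<^sub>m k * A" using Suc by simp
  also have "\<dots> = A * A ^\<^sub>m Suc k" using Suc.prems by (simp add: M_assoc)
  finally show ?case .
qed simp

lemma mat_vec_bound: "A \<in> M \<Longrightarrow> v \<in> V \<Longrightarrow> (\<And>j. j < N \<Longrightarrow> cmod (v $ j) \<le> d) \<Longrightarrow> i < N \<Longrightarrow> 0 \<le> d \<Longrightarrow> cmod ((A *\<^sub>v v) $ i) \<le> nm A * d"
proof -
  assume A: "A \<in> M" "v \<in> V" "\<And>j. j < N \<Longrightarrow> cmod (v $ j) \<le> d" "i < N" "0 \<le> d"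
  have "cmod ((A *\<^sub>v v) $ i) \<le> (\<Sum>j<N. cmod (A $$ (i,j)) * cmod (v $ j))"
    using A by (auto simp: mult_mat_vec_index norm_mult intro!: order_trans[OF norm_sum])
  also have "\<dots> \<le> (\<Sum>j<N. cmod (A $$ (i,j)) * d)"
    using A by (intro sum_mono mult_left_mono) auto
  also have "\<dots> \<le> nm A * d"
    unfolding sum_distrib_right[symmetric] nm_def
    using A by (intro mult_right_mono member_le_sum[where f="\<lambda>i. \<Sum>j<N. cmod (A $$ (i,j))"]) (auto intro!: sum_nonneg)
  finally show ?thesis .
qed

text \<open>Maximise \<open>- H v v\<close> over the compact convex balanced set \<open>S\<close> of vectors whose forward orbit stays in the unit
  polydisc. The set is mapped into itself, so the image of a maximiser is a maximiser, and by the reversed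
  Cauchy-Schwarz inequality for negative vectors two maximisers are proportional.\<close>

lemma bounded_powers_fixH:
  assumes A: "A \<in> U" and bd: "\<And>k. nm (A ^\<^sub>m k) \<le> C"
  shows "fixH n A \<noteq> {}"
proof -
  define S where "S = {v \<in> V. \<forall>j. \<forall>i<N. cmod ((A ^\<^sub>m j *\<^sub>v v) $ i) \<le> 1}"
  have SV: "v \<in> V" if "v \<in> S" for v using that by (simp add: S_def)
  have S1: "cmod (v $ i) \<le> 1" if "v \<in> S" "i < N" for v i
  proof -
    have "cmod ((A ^\<^sub>m 0 *\<^sub>v v) $ i) \<le> 1" using that unfolding S_def by blast
    then show ?thesis using that A by (simp add: SV carrier_matD[OF U_M])
  qed
  have pM: "A ^\<^sub>m j \<in> M" for j using A by simp
  have SA: "A *\<^sub>v v \<in> S" if "v \<in> S" for v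
  proof -
    have "A ^\<^sub>m j *\<^sub>v (A *\<^sub>v v) = A ^\<^sub>m Suc j *\<^sub>v v" for j
      using A that SV by (simp add: M_vec_assoc)
    moreover have "cmod ((A ^\<^sub>m Suc j *\<^sub>v v) $ i) \<le> 1" if "i < N" for i j
      using \<open>v \<in> S\<close> that unfolding S_def by blast
    ultimately show ?thesis using that A SV[OF that] unfolding S_def by simp
  qed
  have Sc: "c \<cdot>\<^sub>v v \<in> S" if "v \<in> S" "cmod c = 1" for v c
    using that pM unfolding S_def
    by (auto simp: M_vec_smult norm_mult carrier_matD[OF pM] carrier_matD[OF U_M[OF A]])
  have Sm: "(1/2) \<cdot>\<^sub>v (v + w) \<in> S" if "v \<in> S" "w \<in> S" for v w
  proof -
    have "cmod ((A ^\<^sub>m j *\<^sub>v ((1/2) \<cdot>\<^sub>v (v + w))) $ i) \<le> 1" if i: "i < N" for i j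
    proof -
      have "(A ^\<^sub>m j *\<^sub>v ((1/2) \<cdot>\<^sub>v (v + w))) $ i = (1/2) * ((A ^\<^sub>m j *\<^sub>v v) $ i + (A ^\<^sub>m j *\<^sub>v w) $ i)"
        using \<open>v \<in> S\<close> \<open>w \<in> S\<close> SV i pM by (simp add: M_vec_simps carrier_matD[OF pM] carrier_matD[OF U_M[OF A]])
      moreover have "cmod ((A ^\<^sub>m j *\<^sub>v v) $ i) \<le> 1" "cmod ((A ^\<^sub>m j *\<^sub>v w) $ i) \<le> 1"
        using \<open>v \<in> S\<close> \<open>w \<in> S\<close> i by (auto simp: S_def)
      moreover have "cmod ((1/2) * (x + y)) \<le> 1" if "cmod x \<le> 1" "cmod y \<le> 1" for x y
        using norm_triangle_ineq[of x y] that by (simp add: norm_mult)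
      ultimately show ?thesis by metis
    qed
    moreover have "(1/2) \<cdot>\<^sub>v (v + w) \<in> V" using SV that by simp
    ultimately show ?thesis unfolding S_def by blast
  qed
  define F where "F v = - Re (H v v)" for v
  have Fb: "F v \<le> real N" if "v \<in> S" for v
  proof -
    have "F v \<le> cmod (H v v)" unfolding F_def using abs_Re_le_cmod[of "H v v"] by linarith
    also have "\<dots> \<le> (\<Sum>i<N. 1)"
      unfolding H_alt
      by (intro sum_norm_le) (auto simp: norm_mult intro!: mult_le_one S1 that)
    finally show ?thesis by simp
  qed
  have ex: "\<exists>v\<in>S. F v > 0"
  proof
    \<comment> \<open>A positive bound for all powers; dividing the negative unit vector by it keeps
      its whole orbit in the unit polydisc.\<close>
    define C' where "C' = \<bar>C\<bar> + 1"
    let ?v = "of_real (1 / C') \<cdot>\<^sub>v unit_vec N 0 :: complex vec"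
    have C': "C' > 0" "C \<le> C'" by (auto simp: C'_def)
    have "cmod ((A ^\<^sub>m j *\<^sub>v ?v) $ i) \<le> 1" if "i < N" for i j
    proof -
      have "cmod ((A ^\<^sub>m j *\<^sub>v ?v) $ i) \<le> nm (A ^\<^sub>m j) * (1 / C')"
        using that C' pM by (intro mat_vec_bound) (auto simp: norm_mult norm_divide)
      also have "\<dots> \<le> C' * (1 / C')" using bd[of j] C' by (intro mult_right_mono) auto
      finally show ?thesis using C' by simp
    qed
    moreover have "?v \<in> V" by simp
    ultimately show "?v \<in> S" unfolding S_def by blast
    have "H (unit_vec N 0) (unit_vec N 0) = -1" by (simp add: H_unit_vec sg_def)
    then show "F ?v > 0" using C' by (simp add: F_def H_simps)
  qed
  define s where "s = (SUP v\<in>S. F v)"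
  have bdd: "bdd_above (F ` S)" using Fb by (auto intro!: bdd_aboveI)
  have le: "F v \<le> s" if "v \<in> S" for v unfolding s_def by (rule cSUP_upper[OF that bdd])
  have s0: "s > 0" using ex le by force
  have "\<exists>v\<in>S. F v > s - 1 / Suc k" for k
  proof (rule ccontr)
    assume "\<not> (\<exists>v\<in>S. F v > s - 1 / Suc k)"
    then have "s \<le> s - 1 / Suc k" unfolding s_def using ex by (intro cSUP_least) (auto simp: not_less)
    then show False by simp
  qed
  \<comment> \<open>A maximising sequence. A subsequence converges, and its limit lies in
    \<open>S\<close> because \<open>S\<close> is defined by closed conditions.\<close>
  then obtain Y where Y: "\<And>k. Y k \<in> S" "\<And>k. F (Y k) > s - 1 / Suc k" by metis
  obtain r v where r: "strict_mono r" "v \<in> V" "vtends (\<lambda>k. Y (r k)) v"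
    using vec_convergent_subseq[of Y 1] S1 Y(1) by metis
  have vS: "v \<in> S"
  proof -
    have "cmod ((A ^\<^sub>m j *\<^sub>v v) $ i) \<le> 1" if "i < N" for i j
    proof (rule tendsto_upperbound)
      have "vtends (\<lambda>k. A ^\<^sub>m j *\<^sub>v Y (r k)) (A ^\<^sub>m j *\<^sub>v v)"
        using r pM Y SV by (intro vtends_mult) auto
      then show "(\<lambda>k. cmod ((A ^\<^sub>m j *\<^sub>v Y (r k)) $ i)) \<longlonglongrightarrow> cmod ((A ^\<^sub>m j *\<^sub>v v) $ i)"
        using that by (intro tendsto_norm) (auto simp: vtends_def)
      show "\<forall>\<^sub>F k in sequentially. cmod ((A ^\<^sub>m j *\<^sub>v Y (r k)) $ i) \<le> 1"
        using Y that by (auto simp: S_def)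
    qed simp
    then show ?thesis using r by (auto simp: S_def)
  qed
  have Fv: "F v = s"
  proof (rule antisym[OF le[OF vS]])
    have lF: "(\<lambda>k. F (Y (r k))) \<longlonglongrightarrow> F v"
      unfolding F_def by (intro tendsto_intros vtends_H r)
    have ls: "(\<lambda>k. s - 1 / Suc (r k)) \<longlonglongrightarrow> s - 0"
      by (intro tendsto_intros LIMSEQ_subseq_LIMSEQ[OF LIMSEQ_Suc[OF lim_inverse_n'] r(1), unfolded o_def])
    have "s - 0 \<le> F v"
      by (rule LIMSEQ_le[OF ls lF]) (use Y(2) less_imp_le in blast)
    then show "s \<le> F v" by simp
  qed
  define w where "w = A *\<^sub>v v"
  have wS: "w \<in> S" using SA vS by (simp add: w_def)
  have vV: "v \<in> V" "w \<in> V" using vS wS SV by auto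
  have "Re (H v v) = - s" using Fv by (simp add: F_def)
  then have Hv: "H v v = - of_real s" by (metis H_self of_real_minus)
  have Hw: "H w w = - of_real s" using Hv A vV by (simp add: w_def U_H)
  \<comment> \<open>The phase \<open>c\<close> makes both cross terms of the midpoint of
    \<open>v\<close> and \<open>c w\<close> equal to \<open>- cmod (H v w)\<close>; its value
    \<open>(s + cmod (H v w)) / 2\<close> of \<open>F\<close> cannot exceed the maximum
    \<open>s\<close>.\<close>
  have le': "cmod (H v w) \<le> s"
  proof (cases "H v w = 0")
    case False
    define h where "h = H v w"
    define c where "c = - (h / of_real (cmod h))"
    have c1: "cmod c = 1" using False by (simp add: c_def h_def norm_divide)
    have hw: "H w v = cnj h" by (simp add: h_def H_cnj)
    have ch: "cnj c * h = - of_real (cmod h)" 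
      using False by (simp add: c_def h_def mult.commute[of "cnj _"] mult_cnj_cmod power2_eq_square)
    have ch': "c * cnj h = - of_real (cmod h)"
      using arg_cong[OF ch, of cnj] by simp
    define x where "x = (1/2) \<cdot>\<^sub>v (v + c \<cdot>\<^sub>v w)"
    have Fx: "F x \<le> s" unfolding x_def by (intro le Sm Sc vS wS c1)
    have cc: "c * cnj c = 1" using c1 by (simp add: mult_cnj_cmod)
    have "H x x = (1/4) * (H v v + (c * cnj c) * H w w + cnj c * h + c * cnj h)"
      using vV by (simp add: x_def H_simps hw h_def[symmetric] algebra_simps)
    also have "\<dots> = of_real (- ((s + cmod h) / 2))" unfolding cc ch ch' Hv Hw by (simp add: field_simps)
    finally have "(s + cmod h) / 2 \<le> s" using Fx by (simp add: F_def)
    then show ?thesis by (simp add: h_def)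
  qed (use s0 in auto)
  \<comment> \<open>The component of the image \<open>w\<close> orthogonal to \<open>v\<close>. By
    \<open>le'\<close> its norm is non-positive, so it vanishes and \<open>w\<close> is a multiple
    of \<open>v\<close>.\<close>
  define u where "u = w + (- (H w v / H v v)) \<cdot>\<^sub>v v"
  have Hv0: "H v v \<noteq> 0" using Hv s0 by simp
  have hw: "H w v = cnj (H v w)" by (simp add: H_cnj)
  have uV: "u \<in> V" using vV by (simp add: u_def)
  have "H u v = 0" using vV Hv0 by (simp add: u_def H_simps)
  then have vu: "H v u = 0" using H_cnj[of u v] by simp
  have "H u u = H u w" using vV uV \<open>H u v = 0\<close> by (subst (2) u_def) (simp add: H_simps)
  also have "\<dots> = H w w - H w v * H v w / H v v" using vV by (simp add: u_def H_simps)
  also have "\<dots> = of_real (- s + (cmod (H v w))\<^sup>2 / s)"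
    unfolding Hv Hw hw using s0 by (simp add: mult.commute[of "cnj _"] mult_cnj_cmod)
  finally have "Re (H u u) = - s + (cmod (H v w))\<^sup>2 / s" by simp
  moreover have "(cmod (H v w))\<^sup>2 \<le> s * s" using le' by (simp add: power2_eq_square mult_mono s0 less_imp_le)
  then have "(cmod (H v w))\<^sup>2 / s \<le> s" using s0 by (simp add: field_simps)
  ultimately have "Re (H u u) \<le> 0" by simp
  moreover have vneg: "Re (H v v) < 0" using Hv s0 by simp
  ultimately have "u = 0\<^sub>v N" using neg_orth_zero[OF vV(1) _ uV _ vu] by simp
  then have "(- (H w v / H v v)) \<cdot>\<^sub>v v + 1 \<cdot>\<^sub>v w = 0\<^sub>v N"
    using vV by (simp add: u_def comm_add_vec[of w N])
  from vec_solve[OF this vV] have "eig A v" unfolding eig_def w_def by auto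
  then show ?thesis using fixH_I[OF A vV(1) vneg] by auto
qed

section \<open>Traces and rank-one limits of powers\<close>

definition tr :: "complex mat \<Rightarrow> complex" where "tr A = (\<Sum>i<N. A $$ (i,i))"

lemma tr_mult_comm: "A \<in> M \<Longrightarrow> B \<in> M \<Longrightarrow> tr (A * B) = tr (B * A)"
  unfolding tr_def by (simp add: mult_mat_index) (subst sum.swap, simp add: mult.commute)

lemma tr_smult: "A \<in> M \<Longrightarrow> tr (c \<cdot>\<^sub>m A) = c * tr A"
  by (simp add: tr_def sum_distrib_left)

lemma tr_adj: "tr (adj A) = cnj (tr A)"
  by (simp add: tr_def adj_index)

lemma tends_tr: "tends X A \<Longrightarrow> (\<lambda>k. tr (X k)) \<longlonglongrightarrow> tr A"
  unfolding tr_def by (auto intro!: tendsto_intros tendsD)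

text \<open>An isometry divided by \<open>s k\<close> multiplies the form by the inverse square of
  \<open>s k\<close>, which tends to 0.\<close>

lemma isotropic_limit:
  assumes Y: "\<And>k. Y k \<in> U" and s: "filterlim s at_top sequentially"
    and R: "R \<in> M" "tends (\<lambda>k. of_real (inverse (s k)) \<cdot>\<^sub>m Y k) R" and vw: "v \<in> V" "w \<in> V"
  shows "H (R *\<^sub>v v) (R *\<^sub>v w) = 0"
proof -
  let ?X = "\<lambda>k. complex_of_real (inverse (s k)) \<cdot>\<^sub>m Y k"
  have "(\<lambda>k. H (?X k *\<^sub>v v) (?X k *\<^sub>v w)) \<longlonglongrightarrow> H (R *\<^sub>v v) (R *\<^sub>v w)"
    by (intro vtends_H tends_vec) (use assms in auto)
  moreover have "H (?X k *\<^sub>v v) (?X k *\<^sub>v w) = of_real (inverse (s k) * inverse (s k)) * H v w" for k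
    using vw Y[of k] by (simp add: smult_M_vec H_simps U_H)
  moreover have "(\<lambda>k. of_real (inverse (s k) * inverse (s k)) * H v w) \<longlonglongrightarrow> of_real (0 * 0) * H v w"
    by (intro tendsto_intros tendsto_inverse_0_at_top s)
  ultimately show ?thesis using LIMSEQ_unique by fastforce
qed

lemma isotropic_range:
  assumes R: "R \<in> M" and iso: "\<And>v w. v \<in> V \<Longrightarrow> w \<in> V \<Longrightarrow> H (R *\<^sub>v v) (R *\<^sub>v w) = 0"
    and e: "e \<in> V" "R *\<^sub>v e \<noteq> 0\<^sub>v N" and v: "v \<in> V"
  obtains c where "R *\<^sub>v v = c \<cdot>\<^sub>v (R *\<^sub>v e)"
  using null_orth_dep[of "R *\<^sub>v e" "R *\<^sub>v v"] assms by (metis M_vec)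

text \<open>The range of \<open>R\<close> is a single line, and a map commuting with
  \<open>R\<close> preserves it.\<close>

lemma isotropic_range_eig:
  assumes A: "A \<in> U" and R: "R \<in> M" and iso: "\<And>v w. v \<in> V \<Longrightarrow> w \<in> V \<Longrightarrow> H (R *\<^sub>v v) (R *\<^sub>v w) = 0"
    and e: "e \<in> V" "R *\<^sub>v e \<noteq> 0\<^sub>v N" and comm: "A * R = R * A"
  shows "eig A (R *\<^sub>v e)"
proof -
  obtain c where "R *\<^sub>v (A *\<^sub>v e) = c \<cdot>\<^sub>v (R *\<^sub>v e)"
    using isotropic_range[OF R iso e, of "A *\<^sub>v e"] A e by auto
  moreover have "A *\<^sub>v (R *\<^sub>v e) = R *\<^sub>v (A *\<^sub>v e)"
    using comm A R e by (metis M_vec_assoc U_M)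
  ultimately show ?thesis by (auto simp: eig_def)
qed

lemma eig_adj_iff:
  assumes "A \<in> U" "v \<in> V" "v \<noteq> 0\<^sub>v N"
  shows "eig (adj A) v \<longleftrightarrow> eig A v"
proof -
  have *: "eig (adj A) v" if A: "A \<in> U" and e: "eig A v" for A
  proof -
    obtain c where c: "A *\<^sub>v v = c \<cdot>\<^sub>v v" using e by (auto simp: eig_def)
    have "c \<noteq> 0" using U_vec_zero[OF A assms(2)] c assms by auto
    have "v = adj A *\<^sub>v (A *\<^sub>v v)" using A assms by (simp add: adj_vec_cancel)
    also have "\<dots> = c \<cdot>\<^sub>v (adj A *\<^sub>v v)" unfolding c using assms by (simp add: M_vec_smult)
    finally have "(1 / c) \<cdot>\<^sub>v v = (1 / c) \<cdot>\<^sub>v (c \<cdot>\<^sub>v (adj A *\<^sub>v v))" by simp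
    also have "\<dots> = adj A *\<^sub>v v" using \<open>c \<noteq> 0\<close> assms by (simp add: smult_smult_assoc)
    finally show ?thesis unfolding eig_def by metis
  qed
  show ?thesis using *[OF assms(1)] *[OF U_adj[OF assms(1)]] adj_adj[OF U_M[OF assms(1)]] by auto
qed

lemma mat_nonzero_vec:
  assumes "R \<in> M" "nm R \<noteq> 0"
  obtains e where "e \<in> V" "R *\<^sub>v e \<noteq> 0\<^sub>v N"
proof -
  have "R = 0\<^sub>m N N" if "\<forall>e\<in>V. R *\<^sub>v e = 0\<^sub>v N"
    by (rule mat_eqI_vec) (use assms that in \<open>auto intro!: eq_vecI simp: index_mult_mat_vec\<close>)
  moreover have "nm (0\<^sub>m N N) = 0" by (simp add: nm_def)
  ultimately show thesis using assms that by metis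
qed

text \<open>The powers \<open>k j\<close> divided by \<open>s j\<close> converge to a rank-one map
  with range spanned by \<open>a\<close> and kernel orthogonal to \<open>b\<close>. The lines of
  \<open>a\<close> and \<open>b\<close> may coincide, so parabolic elements are covered.\<close>

definition rank_one_limit where
  "rank_one_limit A k s R a b \<kappa> \<longleftrightarrow> filterlim s at_top sequentially \<and> (\<forall>j. s j > 0) \<and> R \<in> M \<and>
     tends (\<lambda>j. of_real (inverse (s j)) \<cdot>\<^sub>m (A ^\<^sub>m k j)) R \<and> a \<in> V \<and> b \<in> V \<and> a \<noteq> 0\<^sub>v N \<and> b \<noteq> 0\<^sub>v N \<and>
     H a a = 0 \<and> H b b = 0 \<and> eig A a \<and> eig A b \<and> \<kappa> \<noteq> 0 \<and> (\<forall>v\<in>V. R *\<^sub>v v = (\<kappa> * H v b) \<cdot>\<^sub>v a)"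

text \<open>A limit of normalised powers has isotropic range, hence rank one; it commutes with \<open>A\<close>, so its range, and
  likewise that of its adjoint, is an eigenline.\<close>

lemma unbounded_powers_limit:
  assumes A: "A \<in> U" and ub: "\<And>C. \<exists>k. nm (A ^\<^sub>m k) > C"
  shows "\<exists>k s R a b \<kappa>. rank_one_limit A k s R a b \<kappa>"
proof -
  have "\<forall>j. \<exists>k. nm (A ^\<^sub>m k) > real (Suc j)" using ub by blast
  then obtain f where f: "\<And>j. nm (A ^\<^sub>m f j) > real (Suc j)" by metis
  have fM: "A ^\<^sub>m k \<in> U" for k using A by simp
  \<comment> \<open>Normalisation to norm 1 gives a convergent subsequence with nonzero
    limit.\<close>
  define X where "X j = complex_of_real (inverse (nm (A ^\<^sub>m f j))) \<cdot>\<^sub>m (A ^\<^sub>m f j)" for j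
  have XM: "X j \<in> M" for j using fM by (simp add: X_def)
  have pos: "nm (A ^\<^sub>m f j) > 0" for j using f[of j] by (smt (verit) of_nat_0_le_iff)
  have nX: "nm (X j) = 1" for j using pos[of j] fM by (simp add: X_def nm_smult norm_inverse)
  obtain r R where r: "strict_mono r" "R \<in> M" "tends (\<lambda>j. X (r j)) R"
    using mat_convergent_subseq[of X 1] nX by auto
  have nR: "nm R = 1" using tends_nm[OF r(3)] nX by (simp add: LIMSEQ_const_iff)
  define k where "k = f \<circ> r"
  define s where "s j = nm (A ^\<^sub>m k j)" for j
  have Xs: "X (r j) = of_real (inverse (s j)) \<cdot>\<^sub>m (A ^\<^sub>m k j)" for j by (simp add: X_def s_def k_def)
  have lim: "tends (\<lambda>j. of_real (inverse (s j)) \<cdot>\<^sub>m (A ^\<^sub>m k j)) R" using r(3) unfolding Xs .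
  have spos: "s j > 0" for j using pos by (simp add: s_def k_def)
  have s_top: "filterlim s at_top sequentially"
  proof (rule filterlim_at_top_mono[OF filterlim_real_sequentially])
    have "real j \<le> s j" for j
      using f[of "r j"] seq_suble[OF r(1), of j] by (simp add: s_def k_def)
    then show "\<forall>\<^sub>F j in sequentially. real j \<le> s j" by simp
  qed
  have iso: "H (R *\<^sub>v v) (R *\<^sub>v w) = 0" if "v \<in> V" "w \<in> V" for v w
    by (rule isotropic_limit[OF fM s_top r(2) lim that])
  have lim': "tends (\<lambda>j. of_real (inverse (s j)) \<cdot>\<^sub>m adj (A ^\<^sub>m k j)) (adj R)"
    using tends_adj[OF lim] fM by (simp add: adj_smult)
  have iso': "H (adj R *\<^sub>v v) (adj R *\<^sub>v w) = 0" if "v \<in> V" "w \<in> V" for v w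
    by (rule isotropic_limit[OF U_adj[OF fM] s_top adj_carrier lim' that])
  have comm: "A * R = R * A"
  proof -
    have "tends (\<lambda>j. A * X (r j)) (A * R)" "tends (\<lambda>j. X (r j) * A) (R * A)"
      by (intro tends_mult tends_const r XM U_M[OF A])+
    moreover have "A * X j = X j * A" for j
    proof -
      have "A * A ^\<^sub>m f j = A ^\<^sub>m f j * A" using pow_Suc_left[of A "f j"] A by simp
      then show ?thesis using A fM by (simp add: X_def mult_smult_distrib[where nr=N and n=N and nc=N] 
           mult_smult_assoc_mat[where nr=N and n=N and nc=N])
    qed
    ultimately show ?thesis using tends_unique A r by (metis (no_types, lifting) M_mult U_M ext)
  qed
  have comm': "adj A * adj R = adj R * adj A" using comm A r by (metis adj_mult U_M)
  obtain e where e: "e \<in> V" "R *\<^sub>v e \<noteq> 0\<^sub>v N" using mat_nonzero_vec[OF r(2)] nR by auto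
  obtain e' where e': "e' \<in> V" "adj R *\<^sub>v e' \<noteq> 0\<^sub>v N"
    using mat_nonzero_vec[of "adj R"] nR nm_adj[of R] by auto
  define a where "a = R *\<^sub>v e"
  define b where "b = adj R *\<^sub>v e'"
  have ab: "a \<in> V" "b \<in> V" "a \<noteq> 0\<^sub>v N" "b \<noteq> 0\<^sub>v N" "H a a = 0" "H b b = 0"
    using e e' r iso iso' by (auto simp: a_def b_def)
  have eigs: "eig A a" "eig A b"
    using isotropic_range_eig[OF A r(2) iso e comm] 
      isotropic_range_eig[OF U_adj[OF A] adj_carrier iso' e' comm'] eig_adj_iff[OF A ab(2,4)]
    by (auto simp: a_def b_def)
  \<comment> \<open>Pairing \<open>R v\<close> with this \<open>w\<close> reads off its coefficient
    along \<open>a\<close>; moving \<open>R\<close> to the other side shows that the coefficient is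
    a multiple of \<open>H v b\<close>.\<close>
  obtain w where w: "w \<in> V" "H a w \<noteq> 0" using H_nondeg[of a "0\<^sub>v N"] ab by auto
  obtain c where c: "adj R *\<^sub>v w = c \<cdot>\<^sub>v b"
    using isotropic_range[OF adj_carrier iso' e' w(1)] unfolding b_def by metis
  define \<kappa> where "\<kappa> = cnj c / H a w"
  have Rv: "R *\<^sub>v v = (\<kappa> * H v b) \<cdot>\<^sub>v a" if v: "v \<in> V" for v
  proof -
    obtain d where d: "R *\<^sub>v v = d \<cdot>\<^sub>v a"
      using isotropic_range[OF r(2) iso e v] unfolding a_def by metis
    have "d * H a w = H (R *\<^sub>v v) w" using d ab w by (simp add: H_simps)
    also have "\<dots> = H v (adj R *\<^sub>v w)" by (rule H_adj[OF r(2) v w(1)])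
    also have "\<dots> = cnj c * H v b" using c v ab by (simp add: H_simps)
    finally have "d = \<kappa> * H v b" using w by (simp add: \<kappa>_def field_simps)
    then show ?thesis using d by simp
  qed
  have "\<kappa> \<noteq> 0" using Rv[OF e(1)] e(2) ab by auto
  then show ?thesis
    unfolding rank_one_limit_def using s_top spos r(2) lim ab eigs Rv by blast
qed

text \<open>The diagonal entries come from the unit vectors, and up to \<open>\<kappa>\<close> they
  are the summands of the form. Non-orthogonality thus becomes a nonzero trace.\<close>

lemma tr_rank_one:
  assumes R: "R \<in> M" and b: "b \<in> V" and a: "a \<in> V" and Rv: "\<And>v. v \<in> V \<Longrightarrow> R *\<^sub>v v = (\<kappa> * H v b) \<cdot>\<^sub>v a"
  shows "tr R = \<kappa> * H a b"
proof -
  have "R $$ (i,i) = \<kappa> * (sg i * (a $ i * cnj (b $ i)))" if i: "i < N" for i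
  proof -
    have "R $$ (i,i) = (R *\<^sub>v unit_vec N i) $ i" using i R by (simp add: index_mult_mat_vec)
    also have "\<dots> = \<kappa> * H (unit_vec N i) b * a $ i" using Rv[of "unit_vec N i"] i a by simp
    also have "H (unit_vec N i) b = sg i * cnj (b $ i)"
      using H_unit_vec[OF i b] H_cnj[of b "unit_vec N i"] by (metis complex_cnj_mult sg_simps(3))
    finally show ?thesis by simp
  qed
  then show ?thesis by (simp add: tr_def H_alt sum_distrib_left)
qed

text \<open>A negative eigenvector \<open>v\<close> has unimodular eigenvalue, so its images under
  normalised unbounded powers tend to 0. The rank-one limit would then give
  \<open>H v b = 0\<close>, impossible for a nonzero null \<open>b\<close>.\<close>

lemma elliptic_bounded_powers:
  assumes A: "A \<in> U" and e: "fixH n A \<noteq> {}"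
  shows "\<exists>C. \<forall>k. nm (A ^\<^sub>m k) \<le> C"
proof (rule ccontr)
  assume "\<not> ?thesis"
  then have "\<And>C. \<exists>k. nm (A ^\<^sub>m k) > C" by (auto simp: not_le)
  from unbounded_powers_limit[OF A this] obtain k s R a b \<kappa> where
    L: "filterlim s at_top sequentially" "R \<in> M" "tends (\<lambda>j. of_real (inverse (s j)) \<cdot>\<^sub>m (A ^\<^sub>m k j)) R"
      "a \<in> V" "b \<in> V" "a \<noteq> 0\<^sub>v N" "b \<noteq> 0\<^sub>v N" "H b b = 0" "\<kappa> \<noteq> 0" "\<And>v. v \<in> V \<Longrightarrow> R *\<^sub>v v = (\<kappa> * H v b) \<cdot>\<^sub>v a"
    and pos: "\<And>j. s j > 0"
    unfolding rank_one_limit_def by blast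
  obtain v where v: "v \<in> V" "Re (H v v) < 0" "eig A v" using e fixH_E A by blast
  then obtain c where c: "A *\<^sub>v v = c \<cdot>\<^sub>v v" by (auto simp: eig_def)
  have "c * cnj c = 1" using eig_values[OF A v(1) v(1) c c] v by force
  then have c1: "cmod c = 1" by (metis complex_mod_sqrt_Re_mult_cnj one_complex.sel(1) real_sqrt_one)
  have pow: "A ^\<^sub>m j *\<^sub>v v = c ^ j \<cdot>\<^sub>v v" for j
  proof (induction j)
    case 0 then show ?case using A v by (simp add: carrier_matD[OF U_M])
  next
    case (Suc j)
    then show ?case using A v c by (simp add: M_vec_assoc M_vec_smult smult_smult_assoc mult.commute)
  qed
  have "vtends (\<lambda>j. (of_real (inverse (s j)) \<cdot>\<^sub>m (A ^\<^sub>m k j)) *\<^sub>v v) (R *\<^sub>v v)"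
    using L A v by (intro tends_vec) auto
  then have "(\<lambda>j. (of_real (inverse (s j)) * c ^ k j) * v $ i) \<longlonglongrightarrow> (R *\<^sub>v v) $ i" if "i < N" for i
    using that v A by (simp add: vtends_def smult_M_vec pow smult_smult_assoc)
  moreover have "(\<lambda>j. (of_real (inverse (s j)) * c ^ k j) * v $ i) \<longlonglongrightarrow> 0" for i
  proof -
    have "(\<lambda>j. inverse (s j) * cmod (v $ i)) \<longlonglongrightarrow> 0 * cmod (v $ i)"
      by (intro tendsto_intros tendsto_inverse_0_at_top L(1))
    then have lim: "(\<lambda>j. inverse (s j) * cmod (v $ i)) \<longlonglongrightarrow> 0" by simp
    have bd: "cmod (of_real (inverse (s j)) * c ^ k j * v $ i) \<le> inverse (s j) * cmod (v $ i)" for j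
      using pos[of j] by (simp add: norm_mult norm_power c1 norm_inverse)
    show ?thesis by (rule Lim_null_comparison[OF _ lim]) (use bd in auto)
  qed
  ultimately have "(R *\<^sub>v v) $ i = 0" if "i < N" for i using that LIMSEQ_unique by blast
  then have "R *\<^sub>v v = 0\<^sub>v N" using L v by (intro eq_vecI) auto
  then have "\<kappa> * H v b = 0" using L(10)[OF v(1)] smult_vec_eq_0 L by metis
  then show False using L neg_orth_zero[OF v(1,2), of b] by auto
qed

subsection \<open>Large trace implies loxodromic\<close>

text \<open>The trace is the sum of the \<open>N\<close> diagonal entries of a Schur form. These are
  eigenvalues, and not all of them can have modulus at most 1.\<close>

lemma eigenvalue_from_trace:
  assumes A: "A \<in> M" and t: "cmod (tr A) > real N"
  obtains l v where "cmod l > 1" "v \<in> V" "v \<noteq> 0\<^sub>v N" "A *\<^sub>v v = l \<cdot>\<^sub>v v"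
proof -
  obtain as where as: "char_poly A = (\<Prod>a\<leftarrow>as. [:- a, 1:])" using char_poly_factorized[OF A] by auto
  obtain B where B: "B \<in> M" "upper_triangular B" "similar_mat A B"
    using schur_decomposition_exists[OF A as] by auto
  then obtain P Q where PQ: "similar_mat_wit A B P Q" by (auto simp: similar_mat_def)
  note w = similar_mat_witD2[OF A PQ]
  have "tr A = tr (P * (B * Q))" using w by (simp add: M_assoc)
  also have "\<dots> = tr (B * Q * P)" using w by (intro tr_mult_comm) auto
  also have "\<dots> = tr B" using w by (simp add: M_assoc)
  finally have "cmod (tr A) \<le> (\<Sum>i<N. cmod (B $$ (i,i)))" by (simp add: tr_def norm_sum)
  then have "\<not> (\<forall>i<N. cmod (B $$ (i,i)) \<le> 1)"
    using t sum_mono[of "{..<N}" "\<lambda>i. cmod (B $$ (i,i))" "\<lambda>_. 1"] by force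
  then obtain i where i: "i < N" "cmod (B $$ (i,i)) > 1" by (auto simp: not_le)
  have "B $$ (i,i) \<in> set (diag_mat B)" using i B by (auto simp: diag_mat_def)
  then have "poly (char_poly B) (B $$ (i,i)) = 0"
    unfolding char_poly_upper_triangular[OF B(1,2)] by (rule linear_poly_root)
  then have "eigenvalue A (B $$ (i,i))"
    using eigenvalue_root_char_poly[OF A] char_poly_similar[OF B(3)] by simp
  then show thesis using that[OF i(2)] A unfolding eigenvalue_def eigenvector_def by auto
qed

text \<open>\<open>A\<close> and its inverse \<open>adj A\<close> have traces of the same modulus,
  so each has an expanding eigenvector. Both vectors are null since their eigenvalues are not
  unimodular, and an interior fixed point would make all eigenvalues of null eigenvectors
  unimodular.\<close>

lemma large_trace_loxodromic:
  assumes A: "A \<in> U" and t: "cmod (tr A) > real N"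
  shows "loxodromic n A"
proof -
  have nullv: "H v v = 0" if "B \<in> U" "cmod l \<noteq> 1" "v \<in> V" "B *\<^sub>v v = l \<cdot>\<^sub>v v" for B l v
  proof (rule ccontr)
    assume "H v v \<noteq> 0"
    then have "l * cnj l = 1" using eig_values[OF that(1) that(3) that(3) that(4) that(4)] by simp
    then show False using that(2) by (metis complex_mod_sqrt_Re_mult_cnj one_complex.sel(1) real_sqrt_one)
  qed
  obtain l p where p: "cmod l > 1" "p \<in> V" "p \<noteq> 0\<^sub>v N" "A *\<^sub>v p = l \<cdot>\<^sub>v p"
    using eigenvalue_from_trace A t U_M by metis
  obtain m q where q: "cmod m > 1" "q \<in> V" "q \<noteq> 0\<^sub>v N" "adj A *\<^sub>v q = m \<cdot>\<^sub>v q"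
    using eigenvalue_from_trace[of "adj A"] t by (auto simp: tr_adj)
  have Hp: "H p p = 0" using nullv[OF A _ p(2,4)] p by simp
  have Hq: "H q q = 0" using nullv[OF U_adj[OF A] _ q(2,4)] q by simp
  have eA: "eig A p" "eig A q" using p q eig_adj_iff[OF A q(2,3)] by (auto simp: eig_def)
  have qm: "q = m \<cdot>\<^sub>v (A *\<^sub>v q)"
    using adj_vec_cancel(2)[OF A q(2)] q A by (simp add: M_vec_smult)
  \<comment> \<open>On a common line \<open>A\<close> would have eigenvalue both \<open>l\<close>
    and the inverse of \<open>m\<close>, although both moduli exceed 1.\<close>
  have ne: "cline p \<noteq> cline q"
  proof
    assume "cline p = cline q"
    then obtain c where c: "q = c \<cdot>\<^sub>v p" using cline_eq_iff p q by metis
    have "1 \<cdot>\<^sub>v q = m \<cdot>\<^sub>v (A *\<^sub>v q)" using qm by simp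
    also have "A *\<^sub>v q = l \<cdot>\<^sub>v q" unfolding c using p A by (simp add: M_vec_smult smult_smult_assoc mult.commute)
    finally have "1 \<cdot>\<^sub>v q = (m * l) \<cdot>\<^sub>v q" by (simp add: smult_smult_assoc)
    then have "1 = m * l" using smult_vec_cancel[OF q(2,3)] by blast
    then have "1 = cmod m * cmod l" by (metis norm_mult norm_one)
    moreover have "cmod m * cmod l > 1 * 1" by (intro mult_strict_mono) (use p q in auto)
    ultimately show False by simp
  qed
  have fH: "fixH n A = {}"
  proof (rule ccontr)
    assume "fixH n A \<noteq> {}"
    then obtain v where v: "v \<in> V" "Re (H v v) < 0" "eig A v" using fixH_E A by blast
    then obtain c where c: "A *\<^sub>v v = c \<cdot>\<^sub>v v" by (auto simp: eig_def)
    have "c * cnj c = 1" using eig_values[OF A v(1) v(1) c c] v by force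
    then have c1: "cmod c = 1" by (metis complex_mod_sqrt_Re_mult_cnj one_complex.sel(1) real_sqrt_one)
    have "H v p \<noteq> 0" using neg_orth_zero[OF v(1,2) p(2)] Hp p by auto
    then have "l = c" using eig_values_eq[OF A v(1) p(2) c p(4) _ c1] by simp
    then show False using c1 p by simp
  qed
  have "cline p \<in> fixb n A" "cline q \<in> fixb n A"
    using fixb_I[OF A] p q Hp Hq eA by auto
  then have "fixb n A = {cline p, cline q}"
    using fixb_card_le_2[OF A fH] ne by blast
  moreover have "\<not> is_scalar n A"
  proof
    assume "is_scalar n A"
    then obtain c where c: "A = c \<cdot>\<^sub>m one" by (auto simp: is_scalar_def N_eq)
    have "eig A v" if "v \<in> V" for v unfolding eig_def c using that by (auto simp: smult_M_vec)
    moreover have "Re (H (unit_vec N 0) (unit_vec N 0)) < 0" by (simp add: H_unit_vec sg_def)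
    ultimately show False using fixH_I[OF A, of "unit_vec N 0"] fH by auto
  qed
  ultimately show ?thesis using fH ne unfolding loxodromic_def by blast
qed

lemma pow_add: "A \<in> M \<Longrightarrow> A ^\<^sub>m (j + k) = A ^\<^sub>m j * A ^\<^sub>m k"
  by (induction k) (simp_all add: M_assoc)

lemma nonelliptic_unbounded: "A \<in> U \<Longrightarrow> fixH n A = {} \<Longrightarrow> \<exists>k. nm (A ^\<^sub>m k) > C"
  using bounded_powers_fixH[of A C] by (meson not_le)

text \<open>The range of a limit of normalised powers is a fixed null line.\<close>

lemma nonelliptic_fixb:
  assumes "A \<in> U" "fixH n A = {}"
  shows "fixb n A \<noteq> {}"
proof -
  obtain k s R a b \<kappa> where "rank_one_limit A k s R a b \<kappa>"
    using unbounded_powers_limit nonelliptic_unbounded assms by meson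
  then have "cline a \<in> fixb n A"
    unfolding rank_one_limit_def using fixb_I[OF assms(1)] by blast
  then show ?thesis by auto
qed

subsection \<open>Subgroups and discreteness\<close>

lemma pu_subgroupD:
  assumes "pu_subgroup n G"
  shows pu_subgroup_U: "A \<in> G \<Longrightarrow> A \<in> U"
    and pu_subgroup_one: "one \<in> G"
    and pu_subgroup_mult: "A \<in> G \<Longrightarrow> B \<in> G \<Longrightarrow> A * B \<in> G"
    and pu_subgroup_smult: "A \<in> G \<Longrightarrow> cmod c = 1 \<Longrightarrow> c \<cdot>\<^sub>m A \<in> G"
    and pu_subgroup_adj: "A \<in> G \<Longrightarrow> adj A \<in> G"
proof -
  note G = assms[unfolded pu_subgroup_def, folded N_eq]
  show U: "A \<in> G \<Longrightarrow> A \<in> U" for A using G by blast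
  show "one \<in> G" "A \<in> G \<Longrightarrow> B \<in> G \<Longrightarrow> A * B \<in> G" "A \<in> G \<Longrightarrow> cmod c = 1 \<Longrightarrow> c \<cdot>\<^sub>m A \<in> G"
    using G by blast+
  assume A: "A \<in> G"
  then obtain B where "B \<in> G" "A * B = one" using G by blast
  then show "adj A \<in> G" using U_inv_unique[of A B] U U_M A by metis
qed

lemma pu_subgroup_pow: "pu_subgroup n G \<Longrightarrow> A \<in> G \<Longrightarrow> A ^\<^sub>m k \<in> G"
proof (induction k)
  case 0
  then have "dim_row A = N" using pu_subgroup_U U_M by blast
  then show ?case using 0 by (simp add: pu_subgroup_one)
qed (simp add: pu_subgroup_mult)

text \<open>The traces divided by \<open>s j\<close> tend to the nonzero value \<open>tr R\<close>,
  while \<open>s j\<close> tends to infinity.\<close>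

lemma large_trace_limit:
  assumes s: "filterlim s at_top sequentially" "\<And>j. s j > 0" and X: "\<And>j. X j \<in> M"
    and L: "tends (\<lambda>j. of_real (inverse (s j)) \<cdot>\<^sub>m X j) R" and t: "tr R \<noteq> 0"
  shows "\<exists>j. cmod (tr (X j)) > C"
proof -
  define d where "d = cmod (tr R) / 2"
  have d: "d > 0" "d < cmod (tr R)" using t by (auto simp: d_def)
  have "(\<lambda>j. cmod (tr (of_real (inverse (s j)) \<cdot>\<^sub>m X j))) \<longlonglongrightarrow> cmod (tr R)"
    by (intro tendsto_norm tends_tr L)
  then have "\<forall>\<^sub>F j in sequentially. d < cmod (tr (of_real (inverse (s j)) \<cdot>\<^sub>m X j))"
    using d by (intro order_tendstoD(1))
  moreover have "\<forall>\<^sub>F j in sequentially. \<bar>C\<bar> / d < s j"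
    using s(1) unfolding filterlim_at_top_dense by blast
  ultimately have "\<forall>\<^sub>F j in sequentially. cmod (tr (X j)) > C"
  proof eventually_elim
    case (elim j)
    have "d < inverse (s j) * cmod (tr (X j))"
      using elim(1) s(2)[of j] X by (simp add: tr_smult norm_mult norm_inverse)
    then have "d * s j < cmod (tr (X j))" using s(2)[of j] by (simp add: field_simps)
    moreover have "\<bar>C\<bar> < d * s j" using elim(2) d by (simp add: field_simps)
    ultimately show ?case by linarith
  qed
  then show ?thesis by (rule eventually_happens'[OF sequentially_bot])
qed

lemma smult_mult_smult:
  "X \<in> M \<Longrightarrow> Y \<in> M \<Longrightarrow> (x \<cdot>\<^sub>m X) * (y \<cdot>\<^sub>m Y) = (x * y) \<cdot>\<^sub>m (X * Y)"
  by (rule eq_matI) (auto simp: mult_mat_index sum_distrib_left algebra_simps intro!: sum.cong)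

text \<open>The product of the two rank-one limits has trace
  \<open>\<kappa>' * \<kappa> * H a' b * H a b'\<close>. Both pairings are between fixed points of
  \<open>A\<close> and of \<open>B\<close>, which are distinct and hence not orthogonal.\<close>

lemma large_trace_product:
  assumes A: "A \<in> U" "fixH n A = {}" and B: "B \<in> U" "fixH n B = {}" and disj: "fixb n A \<inter> fixb n B = {}"
  shows "\<exists>k l. cmod (tr (A ^\<^sub>m k * B ^\<^sub>m l)) > C"
proof -
  obtain k s R a b \<kappa> where "rank_one_limit A k s R a b \<kappa>"
    using unbounded_powers_limit nonelliptic_unbounded A by meson
  then have L: "filterlim s at_top sequentially" "\<And>j. s j > 0" "R \<in> M" "tends (\<lambda>j. of_real (inverse (s j)) \<cdot>\<^sub>m (A ^\<^sub>m k j)) R"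
      "a \<in> V" "b \<in> V" "a \<noteq> 0\<^sub>v N" "b \<noteq> 0\<^sub>v N" "H a a = 0" "H b b = 0" "eig A a" "eig A b" "\<kappa> \<noteq> 0" "\<And>v. v \<in> V \<Longrightarrow> R *\<^sub>v v = (\<kappa> * H v b) \<cdot>\<^sub>v a"
    unfolding rank_one_limit_def by blast+
  obtain k' s' R' a' b' \<kappa>' where "rank_one_limit B k' s' R' a' b' \<kappa>'"
    using unbounded_powers_limit nonelliptic_unbounded B by meson
  then have L': "filterlim s' at_top sequentially" "\<And>j. s' j > 0" "R' \<in> M" "tends (\<lambda>j. of_real (inverse (s' j)) \<cdot>\<^sub>m (B ^\<^sub>m k' j)) R'"
      "a' \<in> V" "b' \<in> V" "a' \<noteq> 0\<^sub>v N" "b' \<noteq> 0\<^sub>v N" "H a' a' = 0" "H b' b' = 0" "eig B a'" "eig B b'" "\<kappa>' \<noteq> 0" "\<And>v. v \<in> V \<Longrightarrow> R' *\<^sub>v v = (\<kappa>' * H v b') \<cdot>\<^sub>v a'"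
    unfolding rank_one_limit_def by blast+
  have nz: "H p q \<noteq> 0" if "cline p \<in> fixb n A" "cline q \<in> fixb n B" "p \<in> V" "q \<in> V" "p \<noteq> 0\<^sub>v N" "q \<noteq> 0\<^sub>v N" "H p p = 0" "H q q = 0" for p q
  proof -
    have "cline p \<noteq> cline q" using that(1,2) disj by (metis IntI empty_iff)
    then show ?thesis by (rule null_indep[OF _ refl refl that(3-8)])
  qed
  have n1: "H a b' \<noteq> 0" using L L' by (intro nz fixb_I A B)
  have "H b a' \<noteq> 0" using L L' by (intro nz fixb_I A B)
  then have n2: "H a' b \<noteq> 0" using H_cnj[of b a'] by auto
  let ?X = "\<lambda>j. A ^\<^sub>m k j * B ^\<^sub>m k' j"
  have s: "filterlim (\<lambda>j. s j * s' j) at_top sequentially"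
    by (intro filterlim_at_top_mult_at_top L L')
  have lim: "tends (\<lambda>j. of_real (inverse (s j * s' j)) \<cdot>\<^sub>m ?X j) (R * R')"
  proof -
    have "tends (\<lambda>j. (of_real (inverse (s j)) \<cdot>\<^sub>m (A ^\<^sub>m k j)) * (of_real (inverse (s' j)) \<cdot>\<^sub>m (B ^\<^sub>m k' j))) (R * R')"
      using A B L L' by (intro tends_mult) auto
    moreover have "(x \<cdot>\<^sub>m (A ^\<^sub>m k j)) * (y \<cdot>\<^sub>m (B ^\<^sub>m k' j)) = (x * y) \<cdot>\<^sub>m ?X j" for x y j
      using A B by (intro smult_mult_smult) auto
    ultimately show ?thesis by simp
  qed
  have "tr (R * R') = (\<kappa>' * \<kappa> * H a' b) * H a b'"
  proof (rule tr_rank_one)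
    fix v assume "v \<in> V"
    then show "R * R' *\<^sub>v v = (\<kappa>' * \<kappa> * H a' b * H v b') \<cdot>\<^sub>v a"
      using L L' by (simp add: M_vec_assoc M_vec_smult smult_smult_assoc algebra_simps)
  qed (use L L' in auto)
  then have "tr (R * R') \<noteq> 0" using n1 n2 L L' by auto
  then show ?thesis
    using large_trace_limit[OF s _ _ lim] L(2) L'(2) A B by (metis M_mult U_M U_pow mult_pos_pos)
qed

lemma non_elementary_large_trace:
  assumes G: "pu_subgroup n G" and ne: "non_elementary n G"
  obtains A B f where "A \<in> G" "B \<in> G" "fixH n A = {}" "fixH n B = {}" "fixb n A \<inter> fixb n B = {}"
    "f \<in> G" "cmod (tr f) > real N"
proof -
  obtain A B where AB: "A \<in> G" "B \<in> G" "fixH n A = {}" "fixH n B = {}" "fixb n A \<inter> fixb n B = {}"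
    using ne unfolding non_elementary_def elliptic_def by blast
  obtain k l where "cmod (tr (A ^\<^sub>m k * B ^\<^sub>m l)) > real N"
    using large_trace_product AB G pu_subgroup_U by metis
  then show thesis using that AB G pu_subgroup_mult pu_subgroup_pow by metis
qed

lemma one_smult_M: "Y \<in> M \<Longrightarrow> (1::complex) \<cdot>\<^sub>m Y = Y"
  by (intro eq_matI) auto

lemma pu_gen_subgroup:
  assumes S: "S \<subseteq> U"
  shows "pu_subgroup n (pu_gen n S)"
proof -
  have sub: "A \<in> U" if "A \<in> pu_gen n S" for A
    using that
  proof (induction rule: pu_gen.induct)
    case (gen_scalar c)
    then show ?case using U_smult[OF U_one] by (simp only: N_eq)
  next
    case (gen_inv A B)
    then show ?case using U_inv_unique[of A B] by (simp only: N_eq) (metis N_eq U_adj)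
  qed (use S in auto)
  note I = pu_gen.intros[where n=n and S=S, folded N_eq]
  show ?thesis
    unfolding pu_subgroup_def N_eq[symmetric]
  proof (intro conjI ballI allI impI)
    show "pu_gen n S \<subseteq> U" using sub by blast
    show "one \<in> pu_gen n S" using I(2)[of 1] by (simp add: one_smult_M)
  next
    fix A assume A: "A \<in> pu_gen n S"
    show "\<exists>B\<in>pu_gen n S. A * B = one"
      using I(4)[OF A adj_carrier] adj_mult_U[OF sub[OF A]] by blast
  next
    fix A c assume A: "A \<in> pu_gen n S" and c: "cmod c = 1"
    have "(c \<cdot>\<^sub>m one) * A = c \<cdot>\<^sub>m A"
      using U_M[OF sub[OF A]] by (simp add: mult_smult_assoc_mat[where nr=N and n=N and nc=N])
    then show "c \<cdot>\<^sub>m A \<in> pu_gen n S" using I(3)[OF I(2)[OF c] A] by simp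
  qed (rule I(3))
qed

lemma pu_gen_subset:
  assumes G: "pu_subgroup n G" and S: "S \<subseteq> G"
  shows "pu_gen n S \<subseteq> G"
proof
  fix A assume "A \<in> pu_gen n S"
  then show "A \<in> G"
  proof (induction rule: pu_gen.induct)
    case (gen_scalar c)
    then show ?case using pu_subgroup_smult[OF G pu_subgroup_one[OF G]] by (simp only: N_eq)
  next
    case (gen_inv A B)
    then have "B = adj A" using U_inv_unique[of A B] pu_subgroup_U[OF G] by (simp only: N_eq)
    then show ?case using gen_inv pu_subgroup_adj[OF G] by simp
  qed (use S pu_subgroup_mult[OF G] in auto)
qed

lemma proj_eq_scalar: "proj_eq A one \<Longrightarrow> is_scalar n A"
  by (auto simp: proj_eq_def is_scalar_def N_eq)

lemma discrete_limit_one: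
  assumes D: "pu_subgroup n D" "pu_discrete n D" and X: "\<And>k. X k \<in> D" "tends X one"
  obtains k where "proj_eq (X k) one"
proof -
  have "pu_tendsto n X one"
    unfolding pu_tendsto_def using X one_smult_M pu_subgroup_U[OF D(1)]
    by (intro exI[of _ "\<lambda>_. 1"]) (simp add: tends_mat_tendsto)
  then show thesis
    using D(2) X(1) pu_subgroup_one[OF D(1)] that unfolding pu_discrete_def by blast
qed

text \<open>The identity \<open>adj (X k) * X k = one\<close> passes to the limit.\<close>

lemma tends_U:
  assumes X: "\<And>k. X k \<in> U" "tends X L" "L \<in> M"
  shows "L \<in> U"
proof (rule U_I[OF X(3)])
  have "tends (\<lambda>k. adj (X k) * X k) (adj L * L)"
    by (intro tends_mult tends_adj X) (use X in auto)
  then have "tends (\<lambda>k. one) (adj L * L)" using X by (simp add: adj_mult_U)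
  then show "adj L * L = one" using tends_unique[OF _ tends_const] X by simp
qed

text \<open>Quotients of consecutive terms of a convergent subsequence of powers tend to the
  identity, so by discreteness one of these quotients, a positive power of \<open>g\<close>, is
  scalar.\<close>

lemma discrete_bounded_finite_order:
  assumes D: "pu_subgroup n D" "pu_discrete n D" and g: "g \<in> D" and bd: "\<And>k. nm (g ^\<^sub>m k) \<le> C"
  shows "finite_order n g"
proof -
  have gU: "g \<in> U" using D g pu_subgroup_U by blast
  obtain r L where r: "strict_mono r" "L \<in> M" "tends (\<lambda>k. g ^\<^sub>m r k) L"
    using mat_convergent_subseq[of "\<lambda>k. g ^\<^sub>m k" C] bd by blast
  have LU: "L \<in> U" by (rule tends_U[OF _ r(3,2)]) (use gU in auto)
  let ?Y = "\<lambda>k. g ^\<^sub>m r (Suc k) * adj (g ^\<^sub>m r k)"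
  have "tends ?Y (L * adj L)"
    by (intro tends_mult tends_adj r tends_subseq[OF r(3), of Suc]) (use gU r in \<open>auto simp: strict_mono_Suc_iff\<close>)
  then have "tends ?Y one" using LU by (simp add: adj_mult_U)
  moreover have "?Y k \<in> D" for k
    using D g by (intro pu_subgroup_mult[OF D(1)] pu_subgroup_adj[OF D(1)] pu_subgroup_pow[OF D(1)])
  ultimately obtain k where k: "proj_eq (?Y k) one" using discrete_limit_one[OF D, of ?Y] by blast
  define m where "m = r (Suc k) - r k"
  have "r k < r (Suc k)" using r(1) by (simp add: strict_mono_Suc_iff)
  then have m: "m > 0" "r (Suc k) = m + r k" by (auto simp: m_def)
  have "?Y k = g ^\<^sub>m m" unfolding m(2) using gU by (simp add: pow_add adj_cancel)
  then show ?thesis using m(1) proj_eq_scalar[OF k] unfolding finite_order_def by auto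
qed

subsection \<open>Iterated commutators of elements near the identity\<close>

lemma minus_one_mult: "A \<in> M \<Longrightarrow> B \<in> M \<Longrightarrow> (A - one) * (B - one) = A * B - A - (B - one)"
proof -
  assume A: "A \<in> M" and B: "B \<in> M"
  then have B1: "B - one \<in> M" by auto
  have "(A - one) * (B - one) = A * (B - one) - one * (B - one)"
    by (rule minus_mult_distrib_mat[OF A _ B1]) auto
  also have "A * (B - one) = A * B - A * one" by (rule mult_minus_distrib_mat[OF A B]) auto
  finally show ?thesis using A B1 by simp
qed

definition comm :: "complex mat \<Rightarrow> complex mat \<Rightarrow> complex mat" where
  "comm g a = g * a * (adj g * adj a)"

lemma comm_U [simp]: "g \<in> U \<Longrightarrow> a \<in> U \<Longrightarrow> comm g a \<in> U"
  by (simp add: comm_def)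

lemma M_minus [simp]: "A \<in> M \<Longrightarrow> B \<in> M \<Longrightarrow> A - B \<in> M" by (rule minus_carrier_mat)

lemma U_nm_le: "a \<in> M \<Longrightarrow> nm (a - one) \<le> 1 \<Longrightarrow> nm a \<le> real N + 1"
proof -
  assume a: "a \<in> M" "nm (a - one) \<le> 1"
  have "a = (a - one) + one" using a by (intro eq_matI) auto
  then have "nm a \<le> nm (a - one) + nm one" using nm_add[of "a - one" one] a by simp
  then show ?thesis using a by (simp add: nm_one)
qed

text \<open>\<open>g * a - a * g\<close> is the additive commutator of \<open>g - one\<close> and
  \<open>a - one\<close>, hence quadratically small. The remaining factor has norm at most
  \<open>(N + 1)\<^sup>2\<close>, and \<epsilon> is chosen so that
  \<open>2 * \<epsilon> * (N + 1)\<^sup>2 = 1 / 2\<close>.\<close>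

lemma comm_estimate:
  assumes g: "g \<in> U" "nm (g - one) \<le> \<epsilon>" and a: "a \<in> U" "nm (a - one) \<le> \<epsilon>" and e: "\<epsilon> = 1 / (4 * (real N + 1)\<^sup>2)"
  shows "nm (comm g a - one) \<le> nm (a - one) / 2"
proof -
  have gM: "g \<in> M" and aM: "a \<in> M" using g a by auto
  have "(real N + 1)\<^sup>2 \<ge> 1" by (intro one_le_power) auto
  then have e1: "\<epsilon> \<le> 1" "\<epsilon> > 0" unfolding e by (subst divide_le_eq_1_pos, linarith, linarith) simp
  have ng: "nm (adj g) \<le> real N + 1" "nm (adj a) \<le> real N + 1"
    using U_nm_le[of g] U_nm_le[of a] g a e1 by (auto simp: nm_adj)
  have "(g * a - a * g) * (adj g * adj a) = g * a * (adj g * adj a) - a * g * (adj g * adj a)"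
    using gM aM by (intro minus_mult_distrib_mat[where nr=N and n=N and nc=N]) auto
  also have "a * g * (adj g * adj a) = one"
    using gM aM g a by (simp add: M_assoc adj_cancel adj_mult_U)
  finally have 1: "comm g a - one = (g * a - a * g) * (adj g * adj a)" by (simp add: comm_def)
  have "g * a - a * g = (g - one) * (a - one) - (a - one) * (g - one)"
    unfolding minus_one_mult[OF gM aM] minus_one_mult[OF aM gM]
    using gM aM by (intro eq_matI) (auto simp: carrier_matD[OF gM] carrier_matD[OF aM])
  then have "nm (g * a - a * g) \<le> nm ((g - one) * (a - one)) + nm ((a - one) * (g - one))"
    using gM aM by (simp add: nm_minus)
  also have "\<dots> \<le> nm (g - one) * nm (a - one) + nm (a - one) * nm (g - one)"
    using gM aM by (intro add_mono nm_mult) auto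
  also have "\<dots> \<le> \<epsilon> * nm (a - one) + nm (a - one) * \<epsilon>"
    by (intro add_mono mult_right_mono mult_left_mono g) auto
  finally have 2: "nm (g * a - a * g) \<le> 2 * \<epsilon> * nm (a - one)" by simp
  have "nm (adj g * adj a) \<le> nm (adj g) * nm (adj a)" by (intro nm_mult) auto
  also have "\<dots> \<le> (real N + 1) * (real N + 1)" by (intro mult_mono ng) auto
  finally have 3: "nm (adj g * adj a) \<le> (real N + 1)\<^sup>2" by (simp add: power2_eq_square)
  have "nm (comm g a - one) \<le> nm (g * a - a * g) * nm (adj g * adj a)"
    unfolding 1 using gM aM by (intro nm_mult) auto
  also have "\<dots> \<le> (2 * \<epsilon> * nm (a - one)) * (real N + 1)\<^sup>2"
    using 2 3 e1 by (intro mult_mono) auto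
  also have "\<dots> = nm (a - one) / 2" unfolding e by (simp add: field_simps)
  finally show ?thesis .
qed

primrec comms :: "complex mat \<Rightarrow> complex mat \<Rightarrow> nat \<Rightarrow> complex mat" where
  "comms g h 0 = h"
| "comms g h (Suc k) = comm g (comms g h k)"

lemma comms_bound:
  assumes g: "g \<in> U" "nm (g - one) \<le> \<epsilon>" and h: "h \<in> U" "nm (h - one) \<le> \<epsilon>" and e: "\<epsilon> = 1 / (4 * (real N + 1)\<^sup>2)"
  shows "comms g h k \<in> U \<and> nm (comms g h k - one) \<le> \<epsilon> * (1 / 2) ^ k"
proof (induction k)
  case (Suc k)
  have "\<epsilon> \<ge> 0" by (simp add: e)
  then have "\<epsilon> * (1 / 2) ^ k \<le> \<epsilon>" by (intro mult_left_le power_le_one) auto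
  then have "nm (comm g (comms g h k) - one) \<le> nm (comms g h k - one) / 2"
    using Suc by (intro comm_estimate[OF g _ _ e]) auto
  then show ?case using Suc g by auto
qed (use h in auto)

definition Fix :: "complex mat \<Rightarrow> complex vec set set" where
  "Fix A = {x \<in> pts. act A x = x}"

lemma Fix_eq: "Fix A = fixH n A \<union> fixb n A"
  by (auto simp: Fix_def pts_def fixH_def fixb_def)

text \<open>An injective self-map of a set with at most two points either fixes each point or swaps
  them.\<close>

lemma perm_two_points:
  assumes A: "A \<in> U" and F: "F \<subseteq> pts" "\<And>x. x \<in> F \<Longrightarrow> act A x \<in> F"
    and two: "\<And>x y z. x \<in> F \<Longrightarrow> y \<in> F \<Longrightarrow> z \<in> F \<Longrightarrow> x = y \<or> x = z \<or> y = z" and x: "x \<in> F"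
  shows "act A x = x \<or> (\<exists>y\<in>F. x \<noteq> y \<and> act A x = y \<and> act A y = x)"
proof (cases "act A x = x")
  case False
  define y where "y = act A x"
  have y: "y \<in> F" "act A y \<in> F" using F x by (auto simp: y_def)
  have "act A y \<noteq> y"
  proof
    assume "act A y = y"
    then have "act A y = act A x" by (simp add: y_def)
    then show False using act_inj[OF A] y x F False by (metis subsetD y_def)
  qed
  then have "act A y = x" using two[OF x y] False by (auto simp: y_def)
  then show ?thesis using y False by (auto simp: y_def)
qed auto

text \<open>If \<open>g a g\<^sup>-\<^sup>1 a\<^sup>-\<^sup>1\<close> fixes the fixed points of \<open>g\<close>, then so does the conjugate of \<open>g\<^sup>-\<^sup>1\<close> by \<open>a\<close>, so \<open>a\<close> permutes these
  at most two points; being close to the identity, it cannot swap them.\<close>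

lemma comm_fix_step:
  assumes g: "g \<in> U" and a: "a \<in> U" "nm (a - one) < 1"
    and two: "\<And>x y z. x \<in> Fix g \<Longrightarrow> y \<in> Fix g \<Longrightarrow> z \<in> Fix g \<Longrightarrow> x = y \<or> x = z \<or> y = z"
    and c: "Fix g \<subseteq> Fix (comm g a)"
  shows "Fix g \<subseteq> Fix a"
proof
  have sub: "Fix g \<subseteq> pts" by (auto simp: Fix_def)
  have inv: "act (adj a) x \<in> Fix g" if x: "x \<in> Fix g" for x
  proof -
    have xp: "x \<in> pts" "act g x = x" using x by (auto simp: Fix_def)
    define y where "y = act (adj a) x"
    have yp: "y \<in> pts" using a xp by (simp add: y_def act_pts)
    \<comment> \<open>Cancelling \<open>g\<close>, using that its inverse fixes \<open>x\<close>,
      and then cancelling \<open>a\<close> leaves that the inverse of \<open>g\<close> fixes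
      \<open>y\<close>.\<close>
    have "act (comm g a) x = x" using c x by (auto simp: Fix_def)
    then have "act g (act a (act (adj g) y)) = x"
      using g a xp by (simp add: comm_def act_mult act_pts y_def)
    then have "act a (act (adj g) y) = act (adj g) x"
      using act_adj(1)[OF g, of "act a (act (adj g) y)"] g a yp by (simp add: act_pts)
    also have "act (adj g) x = x" using act_adj(1)[OF g xp(1)] xp by simp
    finally have "act (adj g) y = y"
      using act_adj(1)[OF a(1), of "act (adj g) y"] g yp by (simp add: act_pts y_def)
    then have "act g y = y" using act_adj(2)[OF g yp] by simp
    then show ?thesis using yp by (simp add: Fix_def y_def)
  qed
  fix x assume x: "x \<in> Fix g"
  then have xp: "x \<in> pts" by (simp add: Fix_def)
  from perm_two_points[OF U_adj[OF a(1)] sub inv two x] show "x \<in> Fix a"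
  proof
    assume "act (adj a) x = x"
    then show ?thesis using act_adj(2)[OF a(1) xp] xp by (simp add: Fix_def)
  next
    assume "\<exists>y\<in>Fix g. x \<noteq> y \<and> act (adj a) x = y \<and> act (adj a) y = x"
    then obtain y where "y \<in> Fix g" "x \<noteq> y" "act (adj a) x = y" "act (adj a) y = x" by blast
    then show ?thesis
      using near_one_no_swap[of "adj a" x y] a xp sub by (auto simp: nm_adj_minus_one)
  qed
qed

text \<open>The iterated commutators of \<open>g\<close> with its conjugate \<open>h\<close> become
  trivial, and \<open>comm_fix_step\<close> carries the fixed points of \<open>g\<close> back to
  \<open>h\<close>. So \<open>f\<close> permutes them, and it cannot swap two boundary points
  without fixing an interior point.\<close>

lemma small_element_fixb:
  assumes D: "pu_subgroup n D" "pu_discrete n D" and f: "f \<in> D" "fixH n f = {}" and g: "g \<in> D"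
    and e: "\<epsilon> = 1 / (4 * (real N + 1)\<^sup>2)" "nm (g - one) \<le> \<epsilon>" "nm (f * g * adj f - one) \<le> \<epsilon>"
    and nsc: "\<not> (finite_order n g \<and> infinite (fixb n g))"
  shows "fixb n g \<noteq> {} \<and> fixb n g \<subseteq> fixb n f"
proof -
  have fU: "f \<in> U" and gU: "g \<in> U" using D f g pu_subgroup_U by blast+
  define h where "h = f * g * adj f"
  have hU: "h \<in> U" and hD: "h \<in> D"
    using fU gU f g by (auto simp: h_def intro!: pu_subgroup_mult[OF D(1)] pu_subgroup_adj[OF D(1)])
  have "(real N + 1)\<^sup>2 \<ge> 1" by (intro one_le_power) auto
  then have e1: "\<epsilon> < 1" "\<epsilon> > 0" unfolding e(1) by (subst divide_less_eq_1_pos, linarith, linarith) simp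
  note cb = comms_bound[OF gU e(2) hU e(3)[folded h_def] e(1)]
  have "\<epsilon> * (1 / 2) ^ k \<le> \<epsilon>" for k using e1 by (intro mult_left_le power_le_one) auto
  then have c1: "nm (comms g h k - one) < 1" for k
    using cb[of k] e1 by (meson le_less_trans order_trans)
  have cD: "comms g h k \<in> D" for k
    by (induction k) (auto simp: hD comm_def g intro!: pu_subgroup_mult[OF D(1)] pu_subgroup_adj[OF D(1)])
  have "tends (comms g h) one"
  proof (rule nm_to_zero_tends)
    have "(\<lambda>k. \<epsilon> * (1 / 2) ^ k) \<longlonglongrightarrow> \<epsilon> * 0"
      by (intro tendsto_mult tendsto_const LIMSEQ_power_zero) auto
    then have lim: "(\<lambda>k. \<epsilon> * (1 / 2) ^ k) \<longlonglongrightarrow> 0" by simp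
    show "(\<lambda>k. nm (comms g h k - one)) \<longlonglongrightarrow> 0"
      by (rule Lim_null_comparison[OF _ lim]) (use cb in auto)
  qed (use cb in auto)
  then obtain K where K: "proj_eq (comms g h K) one" using discrete_limit_one[OF D, of "comms g h"] cD by blast
  \<comment> \<open>If \<open>g\<close> is elliptic, its powers are bounded, so it has finite order
    by discreteness. By \<open>nsc\<close> it then has finitely many boundary fixed points, and a
    second fixed point would give infinitely many.\<close>
  have two: "x = y \<or> x = z \<or> y = z" if "x \<in> Fix g" "y \<in> Fix g" "z \<in> Fix g" for x y z
  proof (cases "fixH n g = {}")
    case True
    then show ?thesis using fixb_card_le_2[OF gU] that by (auto simp: Fix_eq)
  next
    case False
    then obtain w where w: "w \<in> fixH n g" by auto
    obtain C where "\<And>k. nm (g ^\<^sub>m k) \<le> C" using elliptic_bounded_powers[OF gU False] by auto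
    then have "finite_order n g" by (rule discrete_bounded_finite_order[OF D g])
    then have "finite (fixb n g)" using nsc by auto
    then have "\<And>y. y \<in> Fix g \<Longrightarrow> y = w"
      using elliptic_two_fixed[OF gU w] by (auto simp: Fix_def)
    then show ?thesis using that by metis
  qed
  \<comment> \<open>Descent from the trivial commutator at index \<open>K\<close>; truncated
    subtraction makes the step idle once index 0 is reached.\<close>
  have "Fix g \<subseteq> Fix (comms g h (K - j))" for j
  proof (induction j)
    case 0
    obtain c where c: "cmod c = 1" "comms g h K = c \<cdot>\<^sub>m one" using K by (auto simp: proj_eq_def)
    then have "c \<noteq> 0" by auto
    then show ?case using c act_scalar by (auto simp: Fix_def)
  next
    case (Suc j)
    note IH = Suc.IH
    show ?case
    proof (cases "K - j")
      case 0
      then show ?thesis using IH by simp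
    next
      case (Suc l)
      then have "Fix g \<subseteq> Fix (comm g (comms g h l))" using IH by simp
      then have "Fix g \<subseteq> Fix (comms g h l)"
        using comm_fix_step[OF gU _ c1 two] cb by blast
      moreover have "K - Suc j = l" using Suc by simp
      ultimately show ?thesis by simp
    qed
  qed
  from this[of K] have "Fix g \<subseteq> Fix h" by simp
  have inv: "act (adj f) x \<in> Fix g" if x: "x \<in> Fix g" for x
  proof -
    have xp: "x \<in> pts" "act h x = x" using x \<open>Fix g \<subseteq> Fix h\<close> by (auto simp: Fix_def)
    have "act f (act g (act (adj f) x)) = x" using xp fU gU by (simp add: h_def act_mult act_pts)
    then have "act g (act (adj f) x) = act (adj f) x"
      using act_adj(1)[OF fU, of "act g (act (adj f) x)"] xp fU gU by (simp add: act_pts)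
    then show ?thesis using xp fU by (simp add: Fix_def act_pts)
  qed
  have sub: "Fix g \<subseteq> pts" by (auto simp: Fix_def)
  \<comment> \<open>The extra premise places both points of a possible swap on the boundary, as
    \<open>swap_fixH\<close> requires.\<close>
  have fx: "act f x = x" if x: "x \<in> Fix g" and "\<And>y. y \<in> Fix g \<Longrightarrow> x \<noteq> y \<Longrightarrow> x \<in> bdry_pts n \<and> y \<in> bdry_pts n" for x
  proof -
    have xp: "x \<in> pts" using x sub by auto
    from perm_two_points[OF U_adj[OF fU] sub inv two x] show ?thesis
    proof
      assume "act (adj f) x = x"
      then show ?thesis using act_adj(2)[OF fU xp] by simp
    next
      assume "\<exists>y\<in>Fix g. x \<noteq> y \<and> act (adj f) x = y \<and> act (adj f) y = x"
      then obtain y where y: "y \<in> Fix g" "x \<noteq> y" "act (adj f) x = y" "act (adj f) y = x" by blast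
      then have "act f x = y" "act f y = x"
        using act_adj(2)[OF fU] xp sub by (metis subsetD)+
      then have "fixH n f \<noteq> {}" using swap_fixH[OF fU, of x y] that(2)[of y] y by blast
      then show ?thesis using f by simp
    qed
  qed
  \<comment> \<open>For elliptic \<open>g\<close> the only fixed point would be interior, and
    \<open>f\<close> would fix it too.\<close>
  have gH: "fixH n g = {}"
  proof (rule ccontr)
    assume ne: "fixH n g \<noteq> {}"
    then obtain w where w: "w \<in> fixH n g" by auto
    obtain C where "\<And>k. nm (g ^\<^sub>m k) \<le> C" using elliptic_bounded_powers[OF gU ne] by auto
    then have "finite_order n g" by (rule discrete_bounded_finite_order[OF D g])
    then have "finite (fixb n g)" using nsc by auto
    then have "\<And>y. y \<in> Fix g \<Longrightarrow> y = w"
      using elliptic_two_fixed[OF gU w] by (auto simp: Fix_def)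
    then have "act f w = w" using fx[of w] w by (auto simp: Fix_eq)
    then have "w \<in> fixH n f" using w by (auto simp: fixH_def)
    then show False using f by simp
  qed
  then have Fg: "Fix g = fixb n g" by (simp add: Fix_eq)
  have "fixb n g \<subseteq> fixb n f"
  proof
    fix x assume x: "x \<in> fixb n g"
    then have "act f x = x" by (intro fx) (auto simp: Fg fixb_def)
    then show "x \<in> fixb n f" using x by (simp add: fixb_def)
  qed
  then show ?thesis using nonelliptic_fixb[OF gU gH] by simp
qed

subsection \<open>The discreteness criterion\<close>

text \<open>A phase-invariant distance from the scalar matrices. Elements along which it decreases strictly are pairwise
  distinct in the projectivised group.\<close>

definition dev :: "complex mat \<Rightarrow> real" where
  "dev A = nm (A - A $$ (0,0) \<cdot>\<^sub>m one)"

lemma dev_smult: "A \<in> M \<Longrightarrow> dev (c \<cdot>\<^sub>m A) = cmod c * dev A"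
proof -
  assume A: "A \<in> M"
  have "c \<cdot>\<^sub>m A - (c \<cdot>\<^sub>m A) $$ (0,0) \<cdot>\<^sub>m one = c \<cdot>\<^sub>m (A - A $$ (0,0) \<cdot>\<^sub>m one)"
    using A by (intro eq_matI) (auto simp: algebra_simps carrier_matD[OF A])
  then show ?thesis using A by (simp add: dev_def nm_smult)
qed

lemma dev_zero:
  assumes "A \<in> M" "dev A = 0"
  shows "A = A $$ (0,0) \<cdot>\<^sub>m one"
proof (rule eq_matI)
  fix i j assume "i < dim_row (A $$ (0,0) \<cdot>\<^sub>m one)" "j < dim_col (A $$ (0,0) \<cdot>\<^sub>m one)"
  then have ij: "i < N" "j < N" by auto
  have "(A - A $$ (0,0) \<cdot>\<^sub>m one) $$ (i,j) = 0"
    by (rule nm_zero) (use assms ij in \<open>auto simp: dev_def\<close>)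
  then show "A $$ (i,j) = (A $$ (0,0) \<cdot>\<^sub>m one) $$ (i,j)" using ij assms by simp
qed (use assms in auto)

text \<open>If \<open>dev\<close> vanishes, the matrix is scalar, and invariance of the form makes
  the scalar unimodular.\<close>

lemma dev_pos:
  assumes A: "A \<in> U" and "\<not> proj_eq A one"
  shows "dev A > 0"
proof (rule ccontr)
  assume "\<not> dev A > 0"
  then have "dev A = 0" unfolding dev_def using nm_nonneg by (metis less_eq_real_def)
  then obtain c where c: "A = c \<cdot>\<^sub>m one" using dev_zero[of A] A by auto
  let ?v = "unit_vec N 0 :: complex vec"
  have "H ?v ?v = H (A *\<^sub>v ?v) (A *\<^sub>v ?v)" using A by (simp add: U_H)
  also have "\<dots> = c * cnj c * H ?v ?v" by (simp add: c smult_M_vec H_simps)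
  finally have "c * cnj c = 1" by (simp add: H_unit_vec sg_def)
  then have "cmod c = 1" by (metis complex_mod_sqrt_Re_mult_cnj one_complex.sel(1) real_sqrt_one)
  then show False using assms(2) c by (auto simp: proj_eq_def)
qed

lemma dev_proj_eq: "B \<in> M \<Longrightarrow> proj_eq A B \<Longrightarrow> dev A = dev B"
  by (auto simp: proj_eq_def dev_smult)

lemma dev_tends:
  assumes "tends X one" "\<And>k. X k \<in> M"
  shows "(\<lambda>k. dev (X k)) \<longlonglongrightarrow> 0"
proof -
  have "(\<lambda>k. dev (X k)) \<longlonglongrightarrow> nm (one - 1 \<cdot>\<^sub>m one)"
    unfolding dev_def
  proof (intro tends_nm tends_minus tends_smult assms tends_const)
    show "(\<lambda>k. X k $$ (0,0)) \<longlonglongrightarrow> 1" using tendsD[OF assms(1), of 0 0] by simp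
  qed (use assms in auto)
  moreover have "nm (one - 1 \<cdot>\<^sub>m one) = 0" by (simp add: nm_def)
  ultimately show ?thesis by simp
qed

text \<open>If the excluded elements occurred infinitely often, a subsequence of them with strictly
  decreasing \<open>dev\<close> would be pairwise distinct and contradict Condition A.\<close>

lemma condition_A_eventually:
  assumes G: "pu_subgroup n G" and cA: "condition_A n G"
    and X: "\<And>k. X k \<in> G" "\<And>k. \<not> proj_eq (X k) one" "tends X one"
  shows "\<exists>K. \<forall>k\<ge>K. \<not> (finite_order n (X k) \<and> infinite (fixb n (X k)))"
proof (rule ccontr)
  let ?P = "\<lambda>k. finite_order n (X k) \<and> infinite (fixb n (X k))"
  assume "\<not> ?thesis"
  then have inf: "\<exists>k\<ge>K. ?P k" for K by blast
  have XU: "X k \<in> U" for k using X pu_subgroup_U[OF G] by blast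
  have step: "\<exists>l. ?P l \<and> k < l \<and> dev (X l) < dev (X k)" for k
  proof -
    have "\<forall>\<^sub>F l in sequentially. dev (X l) < dev (X k)"
      using dev_tends[OF X(3)] dev_pos[OF XU X(2)] XU by (intro order_tendstoD(2)) auto
    then obtain L where "\<And>l. l \<ge> L \<Longrightarrow> dev (X l) < dev (X k)" by (auto simp: eventually_sequentially)
    moreover obtain l where "l \<ge> max L (Suc k)" "?P l" using inf by blast
    ultimately show ?thesis by (intro exI[of _ l]) auto
  qed
  obtain r where r: "\<And>j. ?P (r j)" "\<And>j. r j < r (Suc j) \<and> dev (X (r (Suc j))) < dev (X (r j))"
    using dependent_nat_choice[of "\<lambda>_ k. ?P k" "\<lambda>_ k l. k < l \<and> dev (X l) < dev (X k)"] inf step by blast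
  have mono: "strict_mono r" using r by (simp add: strict_mono_Suc_iff)
  have dec: "dev (X (r j)) < dev (X (r i))" if "i < j" for i j
    using lift_Suc_mono_less[of "\<lambda>j. - dev (X (r j))" i j] r that by simp
  have "\<not> proj_eq (X (r i)) (X (r j))" if "i \<noteq> j" for i j
    using dev_proj_eq[OF U_M[OF XU], of "X (r i)" "r j"] dec[of i j] dec[of j i] that by (metis linorder_neqE_nat order_less_irrefl)
  moreover have "pu_tendsto n (\<lambda>k. X (r k)) one"
  proof -
    have "1 \<cdot>\<^sub>m X k = X k" for k using XU by (simp add: one_smult_M)
    then show ?thesis unfolding pu_tendsto_def
      using tends_subseq[OF X(3) mono] by (intro exI[of _ "\<lambda>_. 1"]) (simp add: tends_mat_tendsto)
  qed
  ultimately have "(\<forall>k. X (r k) \<in> G) \<and> (\<forall>i j. i \<noteq> j \<longrightarrow> \<not> proj_eq (X (r i)) (X (r j))) \<and>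
      (\<forall>k. ?P (r k)) \<and> pu_tendsto n (\<lambda>k. X (r k)) one"
    using X(1) r(1) by blast
  then have "\<exists>Y. (\<forall>k. Y k \<in> G) \<and> (\<forall>i j. i \<noteq> j \<longrightarrow> \<not> proj_eq (Y i) (Y j)) \<and>
      (\<forall>k. finite_order n (Y k) \<and> infinite (fixb n (Y k))) \<and> pu_tendsto n Y one"
    by (rule exI[of _ "\<lambda>k. X (r k)"])
  then show False by (rule notE[OF cA[unfolded condition_A_def, folded N_eq]])
qed

text \<open>Right translation by the inverse of the accumulation point moves it to the identity; the
  phases are absorbed because \<open>G\<close> is closed under unit scalars.\<close>

lemma nondiscrete_sequence:
  assumes G: "pu_subgroup n G" and nd: "\<not> pu_discrete n G"
  obtains X where "\<And>k. X k \<in> G" "\<And>k. \<not> proj_eq (X k) one" "tends X one"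
proof -
  obtain A Y c where A: "A \<in> G" and Y: "\<And>k. Y k \<in> G" "\<And>k. \<not> proj_eq (Y k) A"
    and c: "\<And>k. cmod (c k) = 1" "tends (\<lambda>k. c k \<cdot>\<^sub>m Y k) A"
    using nd unfolding pu_discrete_def pu_tendsto_def tends_mat_tendsto[symmetric] by blast
  have AU: "A \<in> U" and YU: "Y k \<in> U" for k using A Y pu_subgroup_U[OF G] by auto
  define X where "X k = (c k \<cdot>\<^sub>m Y k) * adj A" for k
  show thesis
  proof (rule that)
    show "X k \<in> G" for k
      unfolding X_def using A Y c G
      by (intro pu_subgroup_mult[OF G] pu_subgroup_smult[OF G] pu_subgroup_adj[OF G])
    show "tends X one"
      unfolding X_def adj_mult_U(2)[OF AU, symmetric] using c YU AU by (intro tends_mult tends_const) auto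
    show "\<not> proj_eq (X k) one" for k
    proof
      assume "proj_eq (X k) one"
      then obtain d where d: "cmod d = 1" "X k = d \<cdot>\<^sub>m one" by (auto simp: proj_eq_def)
      have "c k \<cdot>\<^sub>m Y k = X k * A"
        unfolding X_def using AU YU[of k] by (simp add: adj_cancel)
      also have "\<dots> = d \<cdot>\<^sub>m A"
        unfolding d using AU by (simp add: mult_smult_assoc_mat[where nr=N and n=N and nc=N] left_mult_one_mat[OF U_M[OF AU]])
      finally have e: "c k \<cdot>\<^sub>m Y k = d \<cdot>\<^sub>m A" .
      have c0: "c k \<noteq> 0" using c(1)[of k] by auto
      have "Y k = inverse (c k) \<cdot>\<^sub>m (c k \<cdot>\<^sub>m Y k)" using c0 by (intro eq_matI) auto
      also have "\<dots> = (inverse (c k) * d) \<cdot>\<^sub>m A" unfolding e by (intro eq_matI) auto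
      finally have "proj_eq (Y k) A"
        using c(1)[of k] d(1) unfolding proj_eq_def by (intro exI[of _ "inverse (c k) * d"]) (simp add: norm_mult norm_inverse)
      then show False using Y by simp
    qed
  qed
qed

section \<open>Fixed points shared with loxodromic elements\<close>

lemma discrete_subset: "pu_discrete n G \<Longrightarrow> D \<subseteq> G \<Longrightarrow> pu_discrete n D"
  unfolding pu_discrete_def by blast

text \<open>The hypothesis concerns two loxodromic generators, while the commutator argument needs
  the small element \<open>g\<close> itself inside the group.\<close>

lemma pair_generated_contains:
  assumes "f \<in> U" "g \<in> U"
  shows "f \<in> pu_gen n {f, f * g}" "g \<in> pu_gen n {f, f * g}"
proof -
  have D: "pu_subgroup n (pu_gen n {f, f * g})" by (rule pu_gen_subgroup) (use assms in auto)
  show f: "f \<in> pu_gen n {f, f * g}" by (rule gen_base) simp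
  have fg: "f * g \<in> pu_gen n {f, f * g}" by (rule gen_base) simp
  have "adj f * (f * g) \<in> pu_gen n {f, f * g}"
    by (rule pu_subgroup_mult[OF D pu_subgroup_adj[OF D f] fg])
  then show "g \<in> pu_gen n {f, f * g}" using assms by (simp add: adj_cancel)
qed

text \<open>The products \<open>f * X k\<close> tend to \<open>f\<close>, so their traces are
  eventually large and they are loxodromic. Eventually \<open>X k\<close> and its conjugate by
  \<open>f\<close> are also within \<epsilon> of the identity, so \<open>small_element_fixb\<close>
  applies.\<close>

lemma eventually_common_fixed:
  assumes G: "pu_subgroup n G"
    and disc: "\<forall>f\<in>G. \<forall>g\<in>G. loxodromic n f \<and> loxodromic n g \<longrightarrow> pu_discrete n (pu_gen n {f, g})"
    and X: "\<And>k. X k \<in> G" "tends X one" 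
    and cA: "\<forall>\<^sub>F k in sequentially. \<not> (finite_order n (X k) \<and> infinite (fixb n (X k)))"
    and f: "f \<in> G" "cmod (tr f) > real N"
  shows "\<forall>\<^sub>F k in sequentially. fixb n (X k) \<noteq> {} \<and> fixb n (X k) \<subseteq> fixb n f"
proof -
  have fU: "f \<in> U" and XU: "X k \<in> U" for k using f X pu_subgroup_U[OF G] by auto
  have lox: "loxodromic n f" by (rule large_trace_loxodromic[OF fU f(2)])
  define \<epsilon> where "\<epsilon> = 1 / (4 * (real N + 1)\<^sup>2)"
  have e: "\<epsilon> > 0" by (simp add: \<epsilon>_def)
  have "(\<lambda>k. nm (X k - one)) \<longlonglongrightarrow> 0" using XU X by (intro tends_nm_minus) auto
  then have 1: "\<forall>\<^sub>F k in sequentially. nm (X k - one) < \<epsilon>" using e by (intro order_tendstoD(2))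
  have "tends (\<lambda>k. f * X k * adj f) (f * one * adj f)"
    using fU XU X by (intro tends_mult tends_const) auto
  moreover have f1: "f * one = f" by (rule right_mult_one_mat[OF U_M[OF fU]])
  ultimately have "tends (\<lambda>k. f * X k * adj f) one" unfolding f1 adj_mult_U(2)[OF fU] by blast
  then have "(\<lambda>k. nm (f * X k * adj f - one)) \<longlonglongrightarrow> 0" using XU fU by (intro tends_nm_minus) auto
  then have 2: "\<forall>\<^sub>F k in sequentially. nm (f * X k * adj f - one) < \<epsilon>" using e by (intro order_tendstoD(2))
  have "tends (\<lambda>k. f * X k) (f * one)" using fU XU X by (intro tends_mult tends_const) auto
  then have "tends (\<lambda>k. f * X k) f" unfolding f1 .
  then have "(\<lambda>k. cmod (tr (f * X k))) \<longlonglongrightarrow> cmod (tr f)" by (intro tendsto_norm tends_tr)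
  then have 3: "\<forall>\<^sub>F k in sequentially. real N < cmod (tr (f * X k))" using f by (intro order_tendstoD(1))
  from 1 2 3 cA show ?thesis
  proof eventually_elim
    case (elim k)
    let ?D = "pu_gen n {f, f * X k}"
    have D: "pu_subgroup n ?D" by (rule pu_gen_subgroup) (use fU XU in auto)
    have "loxodromic n (f * X k)" by (rule large_trace_loxodromic) (use fU XU elim in auto)
    then have "pu_discrete n ?D" using disc f X lox pu_subgroup_mult[OF G] by blast
    from small_element_fixb[OF D this _ _ _ \<epsilon>_def _ _ elim(4), of f] pair_generated_contains[OF fU XU[of k]] elim lox
    show ?case by (auto simp: loxodromic_def)
  qed
qed

lemma fixb_conj:
  assumes "f \<in> U" "u \<in> U" "x \<in> fixb n (u * f * adj u)"
  shows "act (adj u) x \<in> fixb n f"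
proof -
  have x: "x \<in> bdry_pts n" "x \<in> pts" "act (u * f * adj u) x = x" using assms by (auto simp: fixb_def pts_def)
  then have "act u (act f (act (adj u) x)) = x" using assms by (simp add: act_mult act_pts)
  then have "act f (act (adj u) x) = act (adj u) x"
    using act_adj(1)[OF assms(2), of "act f (act (adj u) x)"] assms x by (simp add: act_pts)
  then show ?thesis using assms x by (simp add: fixb_def act_bdry)
qed

text \<open>The \<open>G\<close>-orbit of \<open>P\<close> lies among the at most two boundary fixed
  points of \<open>f\<close>, and \<open>A\<close> permutes it. A swap would give \<open>A\<close>
  an interior fixed point.\<close>

lemma invariant_pair_fixed:
  assumes G: "pu_subgroup n G" and f: "f \<in> U" "fixH n f = {}" and P: "P \<in> fixb n f"
    and inv: "\<forall>u\<in>G. act u P \<in> fixb n f"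
    and A: "A \<in> G" "fixH n A = {}"
  shows "P \<in> fixb n A"
proof -
  have AU: "A \<in> U" using A pu_subgroup_U[OF G] by blast
  have Pb: "P \<in> bdry_pts n" "P \<in> pts" using P by (auto simp: fixb_def pts_def)
  define F where "F = (\<lambda>u. act u P) ` G"
  have FS: "F \<subseteq> fixb n f" using inv by (auto simp: F_def)
  then have Fb: "F \<subseteq> bdry_pts n" and Fp: "F \<subseteq> pts" by (auto simp: fixb_def pts_def)
  have PF: "P \<in> F" unfolding F_def using pu_subgroup_one[OF G] act_one[OF Pb(2)] by (metis imageI)
  have FA: "act A x \<in> F" if x: "x \<in> F" for x
  proof -
    obtain u where u: "u \<in> G" "x = act u P" using x by (auto simp: F_def)
    then have "act A x = act (A * u) P" using AU Pb pu_subgroup_U[OF G] by (simp add: act_mult)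
    then show ?thesis using u A pu_subgroup_mult[OF G] by (auto simp: F_def)
  qed
  have two: "x = y \<or> x = z \<or> y = z" if "x \<in> F" "y \<in> F" "z \<in> F" for x y z
    using fixb_card_le_2[OF f] that FS by blast
  from perm_two_points[OF AU Fp FA two PF] show ?thesis
  proof
    assume "act A P = P"
    then show ?thesis using Pb by (simp add: fixb_def)
  next
    assume "\<exists>y\<in>F. P \<noteq> y \<and> act A P = y \<and> act A y = P"
    then obtain y where "y \<in> F" "P \<noteq> y" "act A P = y" "act A y = P" by blast
    then show ?thesis using swap_fixH[OF AU, of P y] Pb Fb A by auto
  qed
qed

theorem discreteness_criterion:
  assumes G: "pu_subgroup n G" and ne: "non_elementary n G" and cA: "condition_A n G"
  shows "pu_discrete n G \<longleftrightarrow>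
    (\<forall>f\<in>G. \<forall>g\<in>G. loxodromic n f \<and> loxodromic n g \<longrightarrow> pu_discrete n (pu_gen n {f, g}))"
proof (intro iffI ballI impI)
  fix f g assume "pu_discrete n G" "f \<in> G" "g \<in> G"
  then show "pu_discrete n (pu_gen n {f, g})"
    using discrete_subset pu_gen_subset[OF G, of "{f, g}"] by auto
next
  assume disc: "\<forall>f\<in>G. \<forall>g\<in>G. loxodromic n f \<and> loxodromic n g \<longrightarrow> pu_discrete n (pu_gen n {f, g})"
  show "pu_discrete n G"
  proof (rule ccontr)
    assume "\<not> pu_discrete n G"
    then obtain X where X: "\<And>k. X k \<in> G" "\<And>k. \<not> proj_eq (X k) one" "tends X one"
      using nondiscrete_sequence[OF G] by metis
    have evA: "\<forall>\<^sub>F k in sequentially. \<not> (finite_order n (X k) \<and> infinite (fixb n (X k)))"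
      using condition_A_eventually[OF G cA X] by (auto simp: eventually_sequentially)
    obtain A B f where AB: "A \<in> G" "B \<in> G" "fixH n A = {}" "fixH n B = {}" "fixb n A \<inter> fixb n B = {}"
      and f: "f \<in> G" "cmod (tr f) > real N"
      using non_elementary_large_trace[OF G ne] by metis
    have fU: "f \<in> U" using f pu_subgroup_U[OF G] by blast
    have lox: "fixH n f = {}" "finite (fixb n f)"
      using large_trace_loxodromic[OF fU f(2)] by (auto simp: loxodromic_def)
    note common = eventually_common_fixed[OF G disc X(1,3) evA]
    \<comment> \<open>Pigeonhole: eventually each \<open>X k\<close> has a fixed point in the finite
      set \<open>fixb n f\<close>, so one point is fixed for infinitely many
      \<open>k\<close>.\<close>
    have "\<exists>P\<in>fixb n f. \<exists>\<^sub>F k in sequentially. P \<in> fixb n (X k)"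
    proof (rule ccontr)
      assume "\<not> ?thesis"
      then have "\<forall>P\<in>fixb n f. \<forall>\<^sub>F k in sequentially. P \<notin> fixb n (X k)"
        by (simp add: not_frequently)
      then have "\<forall>\<^sub>F k in sequentially. \<forall>P\<in>fixb n f. P \<notin> fixb n (X k)"
        by (rule eventually_ball_finite[OF lox(2)])
      then have "\<forall>\<^sub>F k in sequentially. False"
        using common[OF f] by eventually_elim blast
      then show False by simp
    qed
    then obtain P where P: "P \<in> fixb n f" "\<exists>\<^sub>F k in sequentially. P \<in> fixb n (X k)" by blast
    have inv: "\<forall>u\<in>G. act u P \<in> fixb n f"
    proof
      fix u assume u: "u \<in> G"
      have uU: "u \<in> U" using u pu_subgroup_U[OF G] by blast
      \<comment> \<open>The conjugate of \<open>f\<close> by the inverse of \<open>u\<close> has the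
        same trace, so it also eventually contains the fixed points of \<open>X k\<close> among its
        own. That it fixes \<open>P\<close> means that \<open>f\<close> fixes the image of
        \<open>P\<close> under \<open>u\<close>.\<close>
      let ?f = "adj u * f * adj (adj u)"
      have "?f \<in> G" using u f by (intro pu_subgroup_mult[OF G] pu_subgroup_adj[OF G])
      moreover have "tr ?f = tr f"
      proof -
        have "tr ?f = tr (adj (adj u) * (adj u * f))" using uU fU by (intro tr_mult_comm) auto
        then show ?thesis using uU fU by (simp add: adj_adj adj_cancel)
      qed
      ultimately have ev: "\<forall>\<^sub>F k in sequentially. fixb n (X k) \<noteq> {} \<and> fixb n (X k) \<subseteq> fixb n ?f"
        using f(2) by (intro common) auto
      \<comment> \<open>The inclusion holds eventually and \<open>P\<close> is fixed frequently, so
        both hold for some \<open>k\<close>; the resulting statement no longer depends on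
        \<open>k\<close>.\<close>
      have "\<exists>\<^sub>F k in sequentially. P \<in> fixb n ?f"
        by (rule frequently_rev_mp[OF P(2) eventually_mono[OF ev]]) blast
      then have "P \<in> fixb n ?f" by simp
      then have "act (adj (adj u)) P \<in> fixb n f" using uU fU by (intro fixb_conj) auto
      then show "act u P \<in> fixb n f" using uU by (simp add: adj_adj)
    qed
    have "P \<in> fixb n A" "P \<in> fixb n B"
      using invariant_pair_fixed[OF G fU lox(1) P(1) inv] AB by blast+
    then show False using AB by blast
  qed
qed

end

theorem theorem3p3:
  fixes n :: nat and G :: "complex mat set"
  assumes "n \<ge> 1"
    and "pu_subgroup n G"
    and "non_elementary n G"
    and "condition_A n G"
  shows "pu_discrete n G \<longleftrightarrow>
    (\<forall>f\<in>G. \<forall>g\<in>G. loxodromic n f \<and> loxodromic n g \<longrightarrow> pu_discrete n (pu_gen n {f, g}))"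
proof -
  interpret hermitian_space n "n + 1" by unfold_locales simp
  show ?thesis using assms(2-4) by (rule discreteness_criterion)
qed

end
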